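(* Let $d\ge1$ and let $K\subset\mathbb{R}^d$ be an origin-symmetric convex body (compact convex set with non-empty interior). For every $f\in\mathrm{BV}(\mathbb{R}^d)$ $$\lim_{\alpha\uparrow1}(1-\alpha)\int_{\mathbb{R}^d}\int_{\mathbb{R}^d}\frac{|f(x+y)-f(x)|}{\|y\|_K^{d+\alpha}}\,\mathrm{d}y\,\mathrm{d}x=2\,\|f\|_{\mathrm{BV},ZK}.$$
   Context: $\|x\|_K=\inf\{\lambda>0:\lambda^{-1}x\in K\}$ is the norm with unit ball $K$. The moment body $ZK$ is the unique convex body whose polar body $Z^*K$ satisfies $\|y\|_{Z^*K}=\frac{d+1}{2}\int_K|y\cdot x|\,\mathrm{d}x$ for $y\in\mathbb{R}^d$. $\mathrm{BV}(\mathbb{R}^d)$ is the space of $u\in L^1(\mathbb{R}^d)$ whose distributional gradient $Du$ is an $\mathbb{R}^d$-valued Radon measure with finite total variation measure $|Du|$. The anisotropic Sobolev semi-norm is $\|f\|_{\mathrm{BV},ZK}=\int_{\mathbb{R}^d}\big\|\frac{Df}{|Df|}\big\|_{Z^*K}\,\mathrm{d}|Df|$, where $Df/|Df|$ is the Radon–Nikodym derivative of $Df$ with respect to $|Df|$. *)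

theory Defs
  imports "HOL-Analysis.Analysis"
begin

definition convex_body :: "'a::euclidean_space set \<Rightarrow> bool" where
  "convex_body K \<longleftrightarrow> compact K \<and> convex K \<and> interior K \<noteq> {}"

definition origin_symmetric :: "'a::euclidean_space set \<Rightarrow> bool" where
  "origin_symmetric K \<longleftrightarrow> uminus ` K = K"

definition body_norm :: "'a::euclidean_space set \<Rightarrow> 'a \<Rightarrow> real" where
  "body_norm K x = Inf {l. l > 0 \<and> inverse l *\<^sub>R x \<in> K}"

definition polar_body :: "'a::euclidean_space set \<Rightarrow> 'a set" where
  "polar_body L = {y. \<forall>x\<in>L. x \<bullet> y \<le> 1}"

definition moment_body :: "'a::euclidean_space set \<Rightarrow> 'a set" where
  "moment_body K = (THE L. convex_body L \<and>
     (\<forall>y. body_norm (polar_body L) y =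
        (real DIM('a) + 1) / 2 * set_lebesgue_integral lebesgue K (\<lambda>x. \<bar>y \<bullet> x\<bar>)))"

primrec continuously_diff :: "nat \<Rightarrow> ('a::euclidean_space \<Rightarrow> real) \<Rightarrow> bool" where
  "continuously_diff 0 \<phi> \<longleftrightarrow> continuous_on UNIV \<phi>"
| "continuously_diff (Suc k) \<phi> \<longleftrightarrow> (\<forall>x. \<phi> differentiable (at x)) \<and>
     (\<forall>b\<in>Basis. continuously_diff k (\<lambda>x. frechet_derivative \<phi> (at x) b))"

definition test_function :: "('a::euclidean_space \<Rightarrow> real) \<Rightarrow> bool" where
  "test_function \<phi> \<longleftrightarrow> (\<forall>k. continuously_diff k \<phi>) \<and> compact (closure {x. \<phi> x \<noteq> 0})"

text \<open>Vector-valued measures are set functions that matter on Borel sets only. On a Euclidean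
  space, a Borel vector measure of finite total variation is automatically Radon.\<close>

definition vector_measure :: "('a::euclidean_space set \<Rightarrow> 'a) \<Rightarrow> bool" where
  "vector_measure \<nu> \<longleftrightarrow> (\<forall>A::nat \<Rightarrow> 'a set. range A \<subseteq> sets borel \<longrightarrow> disjoint_family A \<longrightarrow>
     (\<lambda>n. \<nu> (A n)) sums \<nu> (\<Union>n. A n))"

definition total_variation :: "('a::euclidean_space set \<Rightarrow> 'a) \<Rightarrow> 'a measure" where
  "total_variation \<nu> = measure_of UNIV (sets borel)
     (\<lambda>E. SUP A \<in> {A::nat \<Rightarrow> 'a set. range A \<subseteq> sets borel \<and> disjoint_family A \<and> (\<Union>n. A n) = E}.
        \<Sum>n. ennreal (norm (\<nu> (A n))))"

text \<open>The Radon-Nikodym derivative of a vector measure with respect to its total variation. It is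
  determined up to null sets of the total variation.\<close>

definition polar_density :: "('a::euclidean_space set \<Rightarrow> 'a) \<Rightarrow> 'a \<Rightarrow> 'a" where
  "polar_density \<nu> = (SOME \<sigma>. integrable (total_variation \<nu>) \<sigma> \<and>
     (\<forall>E\<in>sets borel. \<nu> E = set_lebesgue_integral (total_variation \<nu>) E \<sigma>))"

definition vector_integral :: "('a::euclidean_space set \<Rightarrow> 'a) \<Rightarrow> ('a \<Rightarrow> real) \<Rightarrow> 'a" where
  "vector_integral \<nu> \<phi> = (LINT x|total_variation \<nu>. \<phi> x *\<^sub>R polar_density \<nu> x)"

definition is_gradient_measure :: "('a::euclidean_space \<Rightarrow> real) \<Rightarrow> ('a set \<Rightarrow> 'a) \<Rightarrow> bool" where
  "is_gradient_measure u \<nu> \<longleftrightarrow> vector_measure \<nu> \<and> emeasure (total_variation \<nu>) UNIV < \<infinity> \<and>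
     (\<forall>\<phi>. test_function \<phi> \<longrightarrow> (\<forall>b\<in>Basis.
        (LINT x|lebesgue. u x * frechet_derivative \<phi> (at x) b) = - (vector_integral \<nu> \<phi> \<bullet> b)))"

definition BV :: "('a::euclidean_space \<Rightarrow> real) set" where
  "BV = {u. integrable lebesgue u \<and> (\<exists>\<nu>. is_gradient_measure u \<nu>)}"

text \<open>The distributional gradient of a BV function; its values on Borel sets are uniquely
  determined.\<close>

definition gradient_measure :: "('a::euclidean_space \<Rightarrow> real) \<Rightarrow> 'a set \<Rightarrow> 'a" where
  "gradient_measure u = (SOME \<nu>. is_gradient_measure u \<nu>)"

definition anisotropic_BV_seminorm :: "'a::euclidean_space set \<Rightarrow> ('a \<Rightarrow> real) \<Rightarrow> ennreal" where
  "anisotropic_BV_seminorm L f =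
     (\<integral>\<^sup>+x. ennreal (body_norm (polar_body L) (polar_density (gradient_measure f) x))
        \<partial>total_variation (gradient_measure f))"

end

theory Submission
  imports Defs
begin

text \<open>Let \<open>D y = \<integral> \<bar>f (x + y) - f x\<bar> dx\<close> and \<open>V y = \<integral> \<bar>\<sigma> \<bullet> y\<bar> d\<mu>\<close>, where the gradient of \<open>f\<close> is \<open>\<sigma>\<close> times
  \<open>\<mu>\<close>. Testing with smooth functions gives \<open>D \<le> V\<close> and \<open>D (r y) / r \<longlonglongrightarrow> V y\<close> as \<open>r\<close> decreases
  to 0: for a test function \<open>\<phi>\<close>, the map \<open>t \<mapsto> \<integral> f x \<phi> (x - t y) dx\<close> has derivative
  \<open>\<integral> \<phi> (x - t y) (\<sigma> x \<bullet> y) d\<mu>\<close>, and test functions bounded by 1 recover \<open>L\<^sup>1\<close> norms. By Tonelli and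
  the layer-cake formula for \<open>\<parallel>y\<parallel>\<^sub>K\<close>, which replaces polar coordinates, the double integral equals
  \<open>\<integral> (d + \<alpha>) r\<^bsup>-\<alpha>-1\<^esup> G r dr\<close> over \<open>r > 0\<close> with \<open>G r = \<integral>\<^sub>K D (r z) dz\<close>. Since
  \<open>(1 - \<alpha>) r\<^bsup>-\<alpha>\<^esup>\<close> concentrates at 0, the limit is \<open>(d + 1) \<integral>\<^sub>K V\<close>, and Fubini identifies this with
  twice the integral of \<open>\<parallel>\<sigma>\<parallel>\<close> in the norm polar to the moment body.\<close>

section \<open>Smooth functions and test functions\<close>

text \<open>Derivatives fall on test functions only; \<open>f\<close> is never mollified. Two bounds
  on \<open>D\<close> serve the two ends of the integral over \<open>r\<close>:
  \<open>D (r z) \<le> r * V z\<close> near 0, and twice the L1 norm of \<open>f\<close> for large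
  \<open>r\<close>, where the linear bound is no longer integrable. The second contribution stays
  bounded and is wiped out by the factor \<open>1 - \<alpha>\<close>. The factor d + 1 in the limit
  is d + \<alpha> at \<alpha> = 1. The normalisation of the moment body carries (d + 1) / 2, which
  accounts for the 2 in the statement. A second obstacle lies in the definitions. The moment body is
  given by a definite description, so it can be used only after a convex body with the prescribed
  polar norm is shown to exist and to be unique. The polar density is a choice, so a Radon-Nikodym
  density must be exhibited first. Finally \<open>f\<close> is merely Lebesgue measurable; the
  Tonelli arguments run on a Borel representative. All outer integrals take values in
  \<open>ennreal\<close>, so no separate finiteness proof for the double integral is
  required.\<close>

lemma continuously_diff_SucI:
  assumes "\<And>x. (\<phi> has_derivative \<phi>' x) (at x)"
    and "\<And>b. b \<in> Basis \<Longrightarrow> continuously_diff k (\<lambda>x. \<phi>' x b)"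
  shows "continuously_diff (Suc k) \<phi>"
proof -
  \<comment> \<open>\<open>frechet_derivative\<close> is a choice; uniqueness of the derivative
    identifies it with any derivative that has been exhibited.\<close>
  have "frechet_derivative \<phi> (at x) = \<phi>' x" for x
    using frechet_derivative_at[OF assms(1)[of x]] by simp
  then show ?thesis
    using assms by (auto simp: differentiable_def)
qed

lemma continuously_diff_has_derivative:
  assumes "continuously_diff (Suc k) \<phi>"
  shows "(\<phi> has_derivative frechet_derivative \<phi> (at x)) (at x)"
  using assms by (simp add: frechet_derivative_works)

text \<open>Continuity is demanded only at the bottom of the recursion, so the induction starts from
  "differentiable implies continuous". The rules for products, inverses and composites need this,
  because their derivatives contain undifferentiated factors.\<close>

lemma continuously_diff_Suc_imp: "continuously_diff (Suc k) \<phi> \<Longrightarrow> continuously_diff k \<phi>"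
proof (induction k arbitrary: \<phi>)
  case 0
  then show ?case
    by (simp add: continuous_at_imp_continuous_on differentiable_imp_continuous_within)
next
  case (Suc k)
  from Suc.prems have d: "\<forall>x. \<phi> differentiable (at x)"
    and e: "\<And>b. b \<in> Basis \<Longrightarrow> continuously_diff (Suc k) (\<lambda>x. frechet_derivative \<phi> (at x) b)"
    using continuously_diff.simps(2)[of "Suc k" \<phi>] by blast+
  then show ?case
    unfolding continuously_diff.simps(2)[of k \<phi>] using Suc.IH by blast
qed

lemma continuously_diff_const: "continuously_diff k (\<lambda>x. c)"
proof (induction k arbitrary: c)
  case (Suc k)
  then show ?case by (intro continuously_diff_SucI[where \<phi>'="\<lambda>x h. 0"]) auto
qed auto

lemma continuously_diff_add:
  assumes "continuously_diff k f" "continuously_diff k g"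
  shows "continuously_diff k (\<lambda>x. f x + g x)"
  using assms
proof (induction k arbitrary: f g)
  case (Suc k)
  show ?case
    by (rule continuously_diff_SucI, rule has_derivative_add[OF
          continuously_diff_has_derivative[OF Suc.prems(1)]
          continuously_diff_has_derivative[OF Suc.prems(2)]])
       (use Suc in auto)
qed (auto intro: continuous_intros)

lemma continuously_diff_mult:
  assumes "continuously_diff k f" "continuously_diff k g"
  shows "continuously_diff k (\<lambda>x. f x * g x)"
  using assms
proof (induction k arbitrary: f g)
  case (Suc k)
  note * = Suc.prems[THEN continuously_diff_Suc_imp]
  show ?case
    by (rule continuously_diff_SucI, rule has_derivative_mult[OF
          continuously_diff_has_derivative[OF Suc.prems(1)]
          continuously_diff_has_derivative[OF Suc.prems(2)]])
       (use Suc * in \<open>auto intro!: continuously_diff_add\<close>)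
qed (auto intro: continuous_intros)

lemma continuously_diff_diff:
  assumes "continuously_diff k f" "continuously_diff k g"
  shows "continuously_diff k (\<lambda>x. f x - g x)"
  using continuously_diff_add[OF assms(1) continuously_diff_mult[OF continuously_diff_const[of k "-1"] assms(2)]]
  by simp

lemma continuously_diff_sum:
  assumes "\<And>i. i \<in> I \<Longrightarrow> continuously_diff k (f i)"
  shows "continuously_diff k (\<lambda>x. \<Sum>i\<in>I. f i x)"
  using assms
  by (induction I rule: infinite_finite_induct) (auto intro: continuously_diff_const continuously_diff_add)

lemma continuously_diff_inverse:
  assumes "continuously_diff k f" "\<And>x. f x \<noteq> 0"
  shows "continuously_diff k (\<lambda>x. inverse (f x))"
  using assms
proof (induction k arbitrary: f)
  case (Suc k)
  show ?case
  proof (rule continuously_diff_SucI)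
    show "((\<lambda>x. inverse (f x)) has_derivative
        (\<lambda>h. - (inverse (f x) * frechet_derivative f (at x) h * inverse (f x)))) (at x)" for x
      by (rule Deriv.has_derivative_inverse[OF Suc.prems(2) continuously_diff_has_derivative[OF Suc.prems(1)]])
    fix b :: 'a assume b: "b \<in> Basis"
    have "continuously_diff k (\<lambda>x. inverse (f x))"
      using Suc continuously_diff_Suc_imp by blast
    then have "continuously_diff k (\<lambda>x. 0 - inverse (f x) * frechet_derivative f (at x) b * inverse (f x))"
      using Suc.prems b by (intro continuously_diff_mult continuously_diff_diff continuously_diff_const) auto
    then show "continuously_diff k (\<lambda>x. - (inverse (f x) * frechet_derivative f (at x) b * inverse (f x)))"
      by simp
  qed
qed (auto intro: continuous_intros)

lemma continuously_diff_compose_real: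
  fixes g :: "real \<Rightarrow> real"
  assumes "continuously_diff k g" "continuously_diff k u"
  shows "continuously_diff k (\<lambda>x. g (u x))"
  using assms
proof (induction k arbitrary: g u)
  case 0
  then show ?case by (auto intro: continuous_on_compose2)
next
  case (Suc k)
  show ?case
  proof (rule continuously_diff_SucI)
    show "((\<lambda>x. g (u x)) has_derivative
        (\<lambda>h. frechet_derivative g (at (u x)) (frechet_derivative u (at x) h))) (at x)" for x
      by (rule has_derivative_compose[OF continuously_diff_has_derivative[OF Suc.prems(2)]
            continuously_diff_has_derivative[OF Suc.prems(1)]])
    fix b :: 'a assume b: "b \<in> Basis"
    \<comment> \<open>A linear map on the reals is multiplication by its value at 1. The chain rule
      thus yields a product, and 1 is the only basis vector, so the induction hypothesis covers the
      outer factor.\<close>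
    have lin: "frechet_derivative g (at y) h = frechet_derivative g (at y) 1 * h" for y h
    proof -
      have "linear (frechet_derivative g (at y))"
        by (rule has_derivative_linear[OF continuously_diff_has_derivative[OF Suc.prems(1)]])
      from linear_cmul[OF this, of h 1] show ?thesis by simp
    qed
    have "continuously_diff k (\<lambda>x. frechet_derivative g (at (u x)) 1)"
      using Suc.prems by (intro Suc.IH[of "\<lambda>y. frechet_derivative g (at y) 1"] continuously_diff_Suc_imp[OF Suc.prems(2)]) auto
    then have "continuously_diff k (\<lambda>x. frechet_derivative g (at (u x)) 1 * frechet_derivative u (at x) b)"
      using Suc.prems b by (intro continuously_diff_mult) auto
    then show "continuously_diff k (\<lambda>x. frechet_derivative g (at (u x)) (frechet_derivative u (at x) b))"
      by (subst lin)
  qed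
qed

lemma continuously_diff_translate:
  assumes "continuously_diff k f"
  shows "continuously_diff k (\<lambda>x. f (x - a))"
  using assms
proof (induction k arbitrary: f)
  case 0
  then show ?case by (auto intro!: continuous_on_compose2[of UNIV f] continuous_intros)
next
  case (Suc k)
  show ?case
  proof (rule continuously_diff_SucI)
    show "((\<lambda>x. f (x - a)) has_derivative (\<lambda>h. frechet_derivative f (at (x - a)) h)) (at x)" for x
      by (rule has_derivative_compose[OF _ continuously_diff_has_derivative[OF Suc.prems(1)],
            of "\<lambda>x. x - a" "\<lambda>h. h", simplified])
         (auto intro!: derivative_eq_intros)
  qed (use Suc in auto)
qed

lemma continuously_diff_inner: "continuously_diff k (\<lambda>x. (x - c) \<bullet> b)"
proof (cases k)
  case (Suc j)
  show ?thesis unfolding Suc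
    by (rule continuously_diff_SucI[where \<phi>'="\<lambda>x h. h \<bullet> b"])
       (auto intro!: derivative_eq_intros continuously_diff_const)
qed (auto intro!: continuous_intros)

lemma continuously_diff_norm_square: "continuously_diff k (\<lambda>x. (x - c) \<bullet> (x - c))"
proof -
  have "(\<lambda>x. (x - c) \<bullet> (x - c)) = (\<lambda>x. \<Sum>b\<in>Basis. ((x - c) \<bullet> b) * ((x - c) \<bullet> b))"
    by (subst euclidean_inner) simp
  then show ?thesis
    by (simp only:) (intro continuously_diff_sum continuously_diff_mult continuously_diff_inner)
qed

text \<open>The functions \<open>t\<^sup>-\<^sup>n exp (-1/t)\<close> on the positive half-line, extended by zero. Their span is
  closed under differentiation, so they are all smooth.\<close>

definition flat_exp :: "nat \<Rightarrow> real \<Rightarrow> real" where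
  "flat_exp n t = (if t > 0 then inverse t ^ n * exp (- inverse t) else 0)"

text \<open>Substituting s = 1/t reduces the right-hand limit to s^n / exp s tending to 0 at
  infinity; on the left the function vanishes.\<close>

lemma flat_exp_tendsto_0: "(flat_exp n \<longlongrightarrow> 0) (at 0)"
proof -
  have "((\<lambda>t. inverse t ^ n / exp (inverse t)) \<longlongrightarrow> (0::real)) (at_right 0)"
    by (rule filterlim_compose[OF tendsto_power_div_exp_0 filterlim_inverse_at_top_right])
  then have "((\<lambda>t. inverse t ^ n * exp (- inverse t)) \<longlongrightarrow> (0::real)) (at_right 0)"
    by (simp add: exp_minus divide_inverse)
  then have "(flat_exp n \<longlongrightarrow> 0) (at_right 0)"
    by (rule Lim_transform_eventually)
       (auto simp: flat_exp_def eventually_at_filter)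
  moreover have "(flat_exp n \<longlongrightarrow> 0) (at_left 0)"
    by (rule Lim_transform_eventually[OF tendsto_const])
       (auto simp: flat_exp_def eventually_at_filter)
  ultimately show ?thesis by (rule filterlim_split_at_real[rotated])
qed

lemma flat_exp_has_derivative:
  "(flat_exp n has_real_derivative (flat_exp (n + 2) t - real n * flat_exp (n + 1) t)) (at t)"
proof (cases t "0::real" rule: linorder_cases)
  case less
  have "((\<lambda>_. 0) has_real_derivative 0) (at t)" by simp
  then have "(flat_exp n has_real_derivative 0) (at t)"
    by (rule has_field_derivative_transform_within_open[of _ _ _ "{..<0}"])
       (use less in \<open>auto simp: flat_exp_def\<close>)
  with less show ?thesis by (simp add: flat_exp_def)
next
  case equal
  \<comment> \<open>Dividing by \<open>h\<close> raises the exponent by one: the difference quotient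
    at the origin is \<open>flat_exp (Suc n) h\<close>.\<close>
  have "((\<lambda>h. (flat_exp n (0 + h) - flat_exp n 0) / h) \<longlongrightarrow> 0) (at 0)"
    by (rule Lim_transform_eventually[OF flat_exp_tendsto_0[of "Suc n"]])
       (auto simp: flat_exp_def eventually_at_filter field_simps)
  then have "(flat_exp n has_real_derivative 0) (at 0)"
    unfolding DERIV_def .
  with equal show ?thesis by (simp add: flat_exp_def)
next
  case greater
  have "((\<lambda>t. inverse t ^ n * exp (- inverse t)) has_real_derivative
      (inverse t ^ (n + 2) * exp (- inverse t) - real n * (inverse t ^ (n + 1) * exp (- inverse t)))) (at t)"
  proof -
    have i: "(inverse has_real_derivative - (inverse t * inverse t)) (at t)"
      using greater DERIV_inverse[of t UNIV] by (simp add: power2_eq_square)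
    have e: "((\<lambda>t. exp (- inverse t)) has_real_derivative exp (- inverse t) * (inverse t * inverse t)) (at t)"
      using DERIV_fun_exp[OF DERIV_minus[OF i]] by simp
    have p: "((\<lambda>t. inverse t ^ n) has_real_derivative
        real n * (- (inverse t * inverse t) * inverse t ^ (n - Suc 0))) (at t)"
      using DERIV_power[OF i, of n] by simp
    \<comment> \<open>The case split on \<open>n\<close> removes the truncated subtraction
      \<open>n - Suc 0\<close> left by the power rule.\<close>
    show ?thesis
      using DERIV_mult[OF p e] by (rule back_subst) (cases n; simp add: algebra_simps)
  qed
  then have "(flat_exp n has_real_derivative
      (inverse t ^ (n + 2) * exp (- inverse t) - real n * (inverse t ^ (n + 1) * exp (- inverse t)))) (at t)"
    by (rule has_field_derivative_transform_within_open[of _ _ _ "{0<..}"])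
       (use greater in \<open>auto simp: flat_exp_def\<close>)
  with greater show ?thesis by (simp add: flat_exp_def)
qed

lemma continuously_diff_flat_exp: "continuously_diff k (flat_exp n)"
proof (induction k arbitrary: n)
  case 0
  then show ?case
    using flat_exp_has_derivative[of n] by (auto intro: continuous_at_imp_continuous_on DERIV_isCont)
next
  case (Suc k)
  show ?case
  proof (rule continuously_diff_SucI)
    show "(flat_exp n has_derivative
       (\<lambda>h. (flat_exp (n + 2) t - real n * flat_exp (n + 1) t) * h)) (at t)" for t
      using flat_exp_has_derivative[of n t] by (simp add: has_field_derivative_def)
  qed (use Suc in \<open>auto intro!: continuously_diff_diff continuously_diff_mult continuously_diff_const\<close>)
qed

text \<open>Finitely many balls inside \<open>U\<close> cover \<open>C\<close>. The sum
  \<open>\<Psi>\<close> of their bumps is positive exactly on the union of the balls, and by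
  compactness it is at least some \<open>m > 0\<close> on \<open>C\<close>. A smooth step from 0 to
  1 across the values between 0 and \<open>m\<close> is then applied to
  \<open>\<Psi>\<close>.\<close>

lemma smooth_Urysohn:
  fixes C :: "'a::euclidean_space set"
  assumes C: "compact C" and U: "open U" and CU: "C \<subseteq> U"
  obtains \<psi> where "test_function \<psi>" "\<And>x. 0 \<le> \<psi> x" "\<And>x. \<psi> x \<le> 1"
    "\<And>x. x \<in> C \<Longrightarrow> \<psi> x = 1" "\<And>x. x \<notin> U \<Longrightarrow> \<psi> x = 0"
proof -
  \<comment> \<open>Closed balls are taken so that their finite union is a compact subset of
    \<open>U\<close> containing the support.\<close>
  have "\<forall>c\<in>C. \<exists>r>0. cball c r \<subseteq> U"
    using U CU open_contains_cball by blast
  then obtain r where r: "\<And>c. c \<in> C \<Longrightarrow> r c > 0 \<and> cball c (r c) \<subseteq> U" by metis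
  have cover: "C \<subseteq> (\<Union>c\<in>C. ball c (r c))" using r by force
  obtain F where F: "F \<subseteq> C" "finite F" "C \<subseteq> (\<Union>c\<in>F. ball c (r c))"
    by (rule compactE_image[OF C _ cover]) auto
  define \<eta> where "\<eta> c x = flat_exp 0 ((r c)\<^sup>2 - (x - c) \<bullet> (x - c))" for c x
  define \<Psi> where "\<Psi> x = (\<Sum>c\<in>F. \<eta> c x)" for x
  have e0: "flat_exp 0 t \<ge> 0" "flat_exp 0 t > 0 \<longleftrightarrow> t > 0" "flat_exp 0 t = 0 \<longleftrightarrow> t \<le> 0" for t
    by (auto simp: flat_exp_def)
  have \<eta>pos: "\<eta> c x > 0 \<longleftrightarrow> x \<in> ball c (r c)" if "c \<in> F" for c x
  proof -
    have "r c > 0" using r F that by auto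
    then have "(r c)\<^sup>2 > (norm (x - c))\<^sup>2 \<longleftrightarrow> r c > norm (x - c)"
      by (metis norm_ge_zero power_mono_iff linorder_not_less less_eq_real_def zero_less_numeral)
    then show ?thesis
      by (simp add: \<eta>_def e0 dist_commute[of c] dist_norm[of x] power2_norm_eq_inner)
  qed
  have \<eta>0: "\<eta> c x \<ge> 0" for c x by (simp add: \<eta>_def e0)
  have \<Psi>smooth: "continuously_diff k \<Psi>" for k
    unfolding \<Psi>_def \<eta>_def
    by (intro continuously_diff_sum continuously_diff_compose_real[OF continuously_diff_flat_exp]
        continuously_diff_diff continuously_diff_const continuously_diff_norm_square)
  have \<Psi>0: "\<Psi> x \<ge> 0" for x unfolding \<Psi>_def by (intro sum_nonneg \<eta>0)
  have \<Psi>pos: "\<Psi> x > 0 \<longleftrightarrow> x \<in> (\<Union>c\<in>F. ball c (r c))" for x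
  proof -
    have "\<Psi> x = 0 \<longleftrightarrow> (\<forall>c\<in>F. \<eta> c x = 0)"
      unfolding \<Psi>_def using F(2) \<eta>0 by (intro sum_nonneg_eq_0_iff) auto
    moreover have "\<eta> c x = 0 \<longleftrightarrow> x \<notin> ball c (r c)" if "c \<in> F" for c
      using \<eta>pos[OF that, of x] \<eta>0[of c x] by linarith
    ultimately show ?thesis using \<Psi>0[of x] by (auto simp: order.order_iff_strict)
  qed
  have "continuous_on C \<Psi>"
    using \<Psi>smooth[of 0] continuous_on_subset by auto
  have "\<exists>m>0. \<forall>x\<in>C. m \<le> \<Psi> x"
  proof (cases "C = {}")
    case False
    then obtain x0 where "x0 \<in> C" "\<forall>x\<in>C. \<Psi> x0 \<le> \<Psi> x"
      using continuous_attains_inf[OF C False \<open>continuous_on C \<Psi>\<close>] by blast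
    then show ?thesis using F(3) \<Psi>pos by blast
  qed (auto intro: exI[of _ 1])
  then obtain m where m: "m > 0" "\<And>x. x \<in> C \<Longrightarrow> m \<le> \<Psi> x" by blast
  \<comment> \<open>The quotient is 0 where \<open>\<Psi>\<close> is 0 and 1 where
    \<open>\<Psi>\<close> is at least \<open>m\<close>. The denominator never vanishes: as
    \<open>m > 0\<close>, the numbers \<open>\<Psi> x\<close> and \<open>m - \<Psi> x\<close> cannot
    both be nonpositive.\<close>
  define \<psi> where "\<psi> x = flat_exp 0 (\<Psi> x) * inverse (flat_exp 0 (\<Psi> x) + flat_exp 0 (m - \<Psi> x))" for x
  have denom: "flat_exp 0 (\<Psi> x) + flat_exp 0 (m - \<Psi> x) > 0" for x
    using m(1) e0[of "\<Psi> x"] e0[of "m - \<Psi> x"] by (smt (verit))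
  have "continuously_diff k \<psi>" for k
    unfolding \<psi>_def using denom
    by (intro continuously_diff_mult continuously_diff_inverse continuously_diff_add
        continuously_diff_compose_real[OF continuously_diff_flat_exp] \<Psi>smooth
        continuously_diff_diff continuously_diff_const) (metis less_irrefl)
  moreover
  have nz: "{x. \<psi> x \<noteq> 0} \<subseteq> (\<Union>c\<in>F. cball c (r c))"
  proof
    fix x assume "x \<in> {x. \<psi> x \<noteq> 0}"
    then have "\<Psi> x > 0" unfolding \<psi>_def using e0(3)[of "\<Psi> x"] by auto
    then obtain c where "c \<in> F" "x \<in> ball c (r c)" using \<Psi>pos by blast
    then show "x \<in> (\<Union>c\<in>F. cball c (r c))" using ball_subset_cball by blast
  qed
  have comp: "compact (\<Union>c\<in>F. cball c (r c))"
    using F by (intro compact_UN) auto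
  then have "closure {x. \<psi> x \<noteq> 0} \<subseteq> (\<Union>c\<in>F. cball c (r c))"
    by (intro closure_minimal nz compact_imp_closed)
  then have "compact (closure {x. \<psi> x \<noteq> 0})"
    using comp by (meson closed_closure bounded_subset compact_eq_bounded_closed)
  ultimately have "test_function \<psi>" by (simp add: test_function_def)
  moreover have "0 \<le> \<psi> x" "\<psi> x \<le> 1" for x
    unfolding \<psi>_def using denom[of x] e0(1)[of "\<Psi> x"] e0(1)[of "m - \<Psi> x"]
    by (auto simp: field_simps)
  moreover have "\<psi> x = 1" if "x \<in> C" for x
  proof -
    have "flat_exp 0 (m - \<Psi> x) = 0" using m(2)[OF that] by (simp add: e0)
    then show ?thesis using denom[of x] by (simp add: \<psi>_def)
  qed
  moreover have "\<psi> x = 0" if "x \<notin> U" for x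
    using nz r F(1) that by blast
  ultimately show ?thesis using that by blast
qed

section \<open>Test functions: translation, differences and approximation of signs\<close>

lemma test_function_imp_borel_measurable:
  assumes "test_function \<phi>" shows "\<phi> \<in> borel_measurable borel"
proof -
  have "continuously_diff 0 \<phi>" using assms by (simp only: test_function_def)
  then show ?thesis by (simp add: borel_measurable_continuous_onI)
qed

lemma test_function_diff:
  assumes "test_function f" "test_function g"
  shows "test_function (\<lambda>x. f x - g x)"
proof -
  have "{x. f x - g x \<noteq> 0} \<subseteq> {x. f x \<noteq> 0} \<union> {x. g x \<noteq> 0}" by auto
  then have "closure {x. f x - g x \<noteq> 0} \<subseteq> closure {x. f x \<noteq> 0} \<union> closure {x. g x \<noteq> 0}"
    by (metis closure_Un closure_mono)
  moreover have "compact (closure {x. f x \<noteq> 0} \<union> closure {x. g x \<noteq> 0})"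
    using assms by (simp add: test_function_def compact_Un)
  ultimately have "compact (closure {x. f x - g x \<noteq> 0})"
    by (meson closed_closure bounded_subset compact_eq_bounded_closed)
  then show ?thesis
    using assms by (auto simp: test_function_def intro: continuously_diff_diff)
qed

lemma test_function_translate:
  assumes "test_function f"
  shows "test_function (\<lambda>x. f (x - a))"
proof -
  have "{x. f (x - a) \<noteq> 0} = (+) a ` {x. f x \<noteq> 0}"
  proof safe
    fix x assume "f (x - a) \<noteq> 0"
    then show "x \<in> (+) a ` {x. f x \<noteq> 0}" by (intro image_eqI[of _ _ "x - a"]) auto
  qed auto
  then have "compact (closure {x. f (x - a) \<noteq> 0})"
    using assms by (simp add: test_function_def closure_translation compact_translation)
  then show ?thesis
    using assms by (auto simp: test_function_def intro: continuously_diff_translate)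
qed

text \<open>A smooth replacement for the sign of \<open>g\<close>. Inner regularity is applied to
  the finite measure with density \<open>\<bar>g x\<bar>\<close>, not to \<open>M\<close>, so that
  both Lebesgue measure and the variation measure are covered. It gives compact sets that nearly
  exhaust the positivity and the negativity set of \<open>g\<close>.\<close>

lemma test_function_sign_approx:
  fixes M :: "'a::euclidean_space measure" and g :: "'a \<Rightarrow> real"
  assumes M: "sets M = sets borel" and g: "integrable M g" and e: "e > 0"
  obtains \<phi> where "test_function \<phi>" "\<And>x. \<bar>\<phi> x\<bar> \<le> 1"
    "(LINT x|M. \<bar>g x\<bar>) \<le> (LINT x|M. \<phi> x * g x) + e"
proof -
  have gM[measurable]: "g \<in> borel_measurable M" using g by simp
  have gb[measurable]: "g \<in> borel_measurable borel" using gM measurable_cong_sets[OF M refl] by blast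
  define N where "N = density M (\<lambda>x. ennreal \<bar>g x\<bar>)"
  have N: "sets N = sets borel" by (simp add: N_def M)
  have "emeasure N (space N) = (\<integral>\<^sup>+x. ennreal \<bar>g x\<bar> \<partial>M)"
    unfolding N_def by (subst emeasure_density) (auto intro!: nn_integral_cong)
  also have "\<dots> < \<infinity>" using g by (simp add: integrable_iff_bounded)
  finally have fin: "emeasure N (space N) \<noteq> \<infinity>" by auto
  interpret N: finite_measure N by (rule finite_measureI) (use fin in auto)
  \<comment> \<open>The tolerance \<open>e / 4\<close>: there are two exceptional sets, and on them
    the defect is at most twice \<open>\<bar>g x\<bar>\<close>.\<close>
  have approx: "\<exists>C\<subseteq>A. compact C \<and> measure N (A - C) \<le> e / 4" if A: "A \<in> sets borel" for A
  proof -
    have "emeasure N A = (SUP C \<in> {C. C \<subseteq> A \<and> compact C}. emeasure N C)"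
      by (rule inner_regular[OF N fin A])
    moreover have "emeasure N A \<noteq> \<infinity>" by (simp add: N.emeasure_eq_measure)
    ultimately have "\<exists>C\<in>{C. C \<subseteq> A \<and> compact C}. emeasure N A < emeasure N C + ennreal (e / 4)"
      using e by (intro SUP_approx_ennreal) auto
    then obtain C where C: "C \<subseteq> A" "compact C" "emeasure N A < emeasure N C + ennreal (e / 4)" by auto
    have "C \<in> sets N" using C(2) by (simp add: N compact_imp_closed)
    have "measure N A < measure N C + e / 4"
      using C(3) e by (simp add: N.emeasure_eq_measure ennreal_plus[symmetric] ennreal_less_iff del: ennreal_plus)
    moreover have "measure N (A - C) = measure N A - measure N C"
      using A \<open>C \<in> sets N\<close> C(1) by (intro N.finite_measure_Diff) (auto simp: N)
    ultimately show ?thesis using C by (intro exI[of _ C]) auto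
  qed
  have "{x. g x > 0} \<in> sets borel" "{x. g x < 0} \<in> sets borel" by measurable
  then obtain C1 C2 where C1: "C1 \<subseteq> {x. g x > 0}" "compact C1" "measure N ({x. g x > 0} - C1) \<le> e / 4"
    and C2: "C2 \<subseteq> {x. g x < 0}" "compact C2" "measure N ({x. g x < 0} - C2) \<le> e / 4"
    using approx by meson
  \<comment> \<open>Disjoint neighbourhoods keep the two cut-offs from interfering, so their
    difference is exactly 1 on \<open>C1\<close> and -1 on \<open>C2\<close>.\<close>
  have "C1 \<inter> C2 = {}" using C1(1) C2(1) by force
  then obtain U1 U2 where U: "open U1" "open U2" "C1 \<subseteq> U1" "C2 \<subseteq> U2" "U1 \<inter> U2 = {}"
    using separation_normal[of C1 C2] C1 C2 compact_imp_closed by metis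
  obtain \<psi>1 where 1: "test_function \<psi>1" "\<And>x. 0 \<le> \<psi>1 x" "\<And>x. \<psi>1 x \<le> 1"
    "\<And>x. x \<in> C1 \<Longrightarrow> \<psi>1 x = 1" "\<And>x. x \<notin> U1 \<Longrightarrow> \<psi>1 x = 0"
    by (rule smooth_Urysohn[OF C1(2) U(1,3)]) blast
  obtain \<psi>2 where 2: "test_function \<psi>2" "\<And>x. 0 \<le> \<psi>2 x" "\<And>x. \<psi>2 x \<le> 1"
    "\<And>x. x \<in> C2 \<Longrightarrow> \<psi>2 x = 1" "\<And>x. x \<notin> U2 \<Longrightarrow> \<psi>2 x = 0"
    by (rule smooth_Urysohn[OF C2(2) U(2,4)]) blast
  define \<phi> where "\<phi> x = \<psi>1 x - \<psi>2 x" for x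
  have t: "test_function \<phi>" unfolding \<phi>_def using 1 2 by (intro test_function_diff) auto
  have b: "\<bar>\<phi> x\<bar> \<le> 1" for x using 1(2,3)[of x] 2(2,3)[of x] by (auto simp: \<phi>_def)
  define S where "S = ({x. g x > 0} - C1) \<union> ({x. g x < 0} - C2)"
  have S[measurable]: "S \<in> sets borel"
    unfolding S_def using C1(2) C2(2) by (intro sets.Un sets.Diff) (auto intro: borel_compact)
  have [measurable]: "\<phi> \<in> borel_measurable borel" by (rule test_function_imp_borel_measurable[OF t])
  have m\<phi>[measurable]: "\<phi> \<in> borel_measurable M" by (simp add: measurable_cong_sets[OF M refl])
  have SM[measurable]: "S \<in> sets M" using S M by simp
  have i: "integrable M (\<lambda>x. \<phi> x * g x)"
    by (rule Bochner_Integration.integrable_bound[OF g]) (auto simp: abs_mult intro!: mult_left_le_one_le b)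
  have iS: "integrable M (\<lambda>x. 2 * (\<bar>g x\<bar> * indicator S x))"
    by (rule Bochner_Integration.integrable_bound[OF integrable_mult_right[OF g, of 2]]) (auto split: split_indicator)
  have "(LINT x|M. \<bar>g x\<bar>) - (LINT x|M. \<phi> x * g x) = (LINT x|M. \<bar>g x\<bar> - \<phi> x * g x)"
    using g i by (subst Bochner_Integration.integral_diff) auto
  also have "\<dots> \<le> (LINT x|M. 2 * (\<bar>g x\<bar> * indicator S x))"
  proof (rule integral_mono)
    show "integrable M (\<lambda>x. \<bar>g x\<bar> - \<phi> x * g x)"
      using g i by auto
    show "integrable M (\<lambda>x. 2 * (\<bar>g x\<bar> * indicator S x))" by (rule iS)
    fix x
    show "\<bar>g x\<bar> - \<phi> x * g x \<le> 2 * (\<bar>g x\<bar> * indicator S x)"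
    proof (cases "x \<in> S")
      case True
      have "\<bar>\<phi> x * g x\<bar> \<le> \<bar>g x\<bar>" using b[of x] by (simp add: abs_mult mult_left_le_one_le)
      then show ?thesis using True by auto
    next
      case False
      then consider "x \<in> C1" | "x \<in> C2" | "g x = 0" unfolding S_def by force
      then show ?thesis
      proof cases
        case 1
        moreover have "x \<notin> U2" using 1 U by auto
        ultimately have "\<phi> x = 1" using \<open>\<And>x. x \<in> C1 \<Longrightarrow> \<psi>1 x = 1\<close> 2(5) by (simp add: \<phi>_def)
        then show ?thesis using 1 C1(1) False by auto
      next
        case 2
        moreover have "x \<notin> U1" using 2 U by auto
        ultimately have "\<phi> x = -1" using \<open>\<And>x. x \<in> C2 \<Longrightarrow> \<psi>2 x = 1\<close> 1(5) by (simp add: \<phi>_def)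
        then show ?thesis using 2 C2(1) False by auto
      qed auto
    qed
  qed
  also have "\<dots> = 2 * measure N S"
  proof -
    have "measure N S = (LINT x|N. indicator S x)"
      by (simp add: N sets_eq_imp_space_eq[OF N])
    also have "\<dots> = (LINT x|M. \<bar>g x\<bar> *\<^sub>R indicator S x)"
      unfolding N_def by (subst integral_density) auto
    finally show ?thesis by simp
  qed
  finally have "(LINT x|M. \<bar>g x\<bar>) - (LINT x|M. \<phi> x * g x) \<le> 2 * measure N S" .
  moreover have "measure N S \<le> measure N ({x. g x > 0} - C1) + measure N ({x. g x < 0} - C2)"
    unfolding S_def using C1(2) C2(2) by (intro measure_Un_le) (auto simp: N intro: borel_compact)
  ultimately have "(LINT x|M. \<bar>g x\<bar>) \<le> (LINT x|M. \<phi> x * g x) + e"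
    using C1(3) C2(3) by linarith
  with t b show ?thesis using that by blast
qed

section \<open>Derivatives of test functions and uniform bounds\<close>

lemma test_function_has_derivative:
  "test_function \<phi> \<Longrightarrow> (\<phi> has_derivative frechet_derivative \<phi> (at x)) (at x)"
  unfolding test_function_def using continuously_diff_has_derivative by blast

lemma test_function_derivative_borel_measurable:
  assumes "test_function \<phi>" "b \<in> Basis"
  shows "(\<lambda>x. frechet_derivative \<phi> (at x) b) \<in> borel_measurable borel"
proof -
  have "continuously_diff (Suc 0) \<phi>" using assms(1) by (simp only: test_function_def)
  then show ?thesis using assms(2) by (simp add: borel_measurable_continuous_onI)
qed

lemma test_function_derivative_sum:
  assumes "test_function \<phi>"
  shows "frechet_derivative \<phi> (at x) h = (\<Sum>b\<in>Basis. (h \<bullet> b) * frechet_derivative \<phi> (at x) b)"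
proof -
  interpret linear "frechet_derivative \<phi> (at x)"
    by (rule has_derivative_linear[OF test_function_has_derivative[OF assms]])
  have "frechet_derivative \<phi> (at x) h = frechet_derivative \<phi> (at x) (\<Sum>b\<in>Basis. (h \<bullet> b) *\<^sub>R b)"
    by (simp add: euclidean_representation)
  also have "\<dots> = (\<Sum>b\<in>Basis. (h \<bullet> b) * frechet_derivative \<phi> (at x) b)"
    by (simp add: sum scale)
  finally show ?thesis .
qed

lemma test_function_derivative_bounded:
  fixes \<phi> :: "'a::euclidean_space \<Rightarrow> real"
  assumes t: "test_function \<phi>"
  obtains B where "B \<ge> 0" "\<And>x h. \<bar>frechet_derivative \<phi> (at x) h\<bar> \<le> B * norm h"
proof -
  let ?S = "closure {x. \<phi> x \<noteq> 0}"
  have S: "compact ?S" using t by (simp add: test_function_def)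
  have zero: "frechet_derivative \<phi> (at x) = (\<lambda>h. 0)" if "x \<notin> ?S" for x
  proof -
    have "(\<phi> has_derivative (\<lambda>h. 0)) (at x)"
      by (rule has_derivative_transform_within_open[OF has_derivative_const[where c=0], where s="- ?S"])
         (use that closure_subset[of "{x. \<phi> x \<noteq> 0}"] in auto)
    then show ?thesis by (rule frechet_derivative_at[symmetric])
  qed
  have "\<exists>B. \<forall>x. \<bar>frechet_derivative \<phi> (at x) b\<bar> \<le> B" if b: "b \<in> Basis" for b
  proof -
    have "continuously_diff (Suc 0) \<phi>" using t by (simp only: test_function_def)
    then have "continuous_on ?S (\<lambda>x. frechet_derivative \<phi> (at x) b)"
      using b by (auto intro: continuous_on_subset)
    then have "bounded ((\<lambda>x. frechet_derivative \<phi> (at x) b) ` ?S)"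
      using S compact_continuous_image compact_imp_bounded by blast
    then obtain B where "\<forall>x\<in>?S. \<bar>frechet_derivative \<phi> (at x) b\<bar> \<le> B"
      by (auto simp: bounded_iff)
    \<comment> \<open>The maximum with 0 covers points off the support; if the support is empty,
      \<open>B\<close> is unconstrained and may be negative.\<close>
    then have "\<bar>frechet_derivative \<phi> (at x) b\<bar> \<le> max B 0" for x
      using zero[of x] by (cases "x \<in> ?S") (auto simp: le_max_iff_disj)
    then show ?thesis by blast
  qed
  then obtain B where B: "\<And>x b. b \<in> Basis \<Longrightarrow> \<bar>frechet_derivative \<phi> (at x) b\<bar> \<le> B b" by metis
  \<comment> \<open>Any point of the space shows that the bound is nonnegative;
    \<open>undefined\<close> merely names one.\<close>
  have B0: "B b \<ge> 0" if "b \<in> Basis" for b using B[OF that, of undefined] by linarith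
  show ?thesis
  proof
    show "0 \<le> sum B Basis" by (intro sum_nonneg B0)
    fix x h
    have "\<bar>frechet_derivative \<phi> (at x) h\<bar> \<le> (\<Sum>b\<in>Basis. \<bar>(h \<bullet> b) * frechet_derivative \<phi> (at x) b\<bar>)"
      by (subst test_function_derivative_sum[OF t]) (rule sum_abs)
    also have "\<dots> \<le> (\<Sum>b\<in>Basis. norm h * B b)"
      unfolding abs_mult by (intro sum_mono mult_mono Basis_le_norm B) auto
    finally show "\<bar>frechet_derivative \<phi> (at x) h\<bar> \<le> sum B Basis * norm h"
      by (simp add: sum_distrib_left mult.commute)
  qed
qed

lemma test_function_bounded:
  fixes \<phi> :: "'a::euclidean_space \<Rightarrow> real"
  assumes t: "test_function \<phi>"
  obtains B where "\<And>x. \<bar>\<phi> x\<bar> \<le> B"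
proof -
  let ?S = "closure {x. \<phi> x \<noteq> 0}"
  have S: "compact ?S" using t by (simp add: test_function_def)
  have "continuously_diff 0 \<phi>" using t by (simp only: test_function_def)
  then have "continuous_on ?S \<phi>" using continuous_on_subset by auto
  then have "bounded (\<phi> ` ?S)"
    using S compact_continuous_image compact_imp_bounded by blast
  then obtain B where B: "\<forall>x\<in>?S. \<bar>\<phi> x\<bar> \<le> B"
    by (auto simp: bounded_iff)
  have "\<bar>\<phi> x\<bar> \<le> max B 0" for x
    using B closure_subset[of "{x. \<phi> x \<noteq> 0}"] by (cases "\<phi> x = 0") (auto simp: le_max_iff_disj)
  then show ?thesis using that by blast
qed

text \<open>The mean value inequality bounds difference quotients uniformly in the base point, which
  supplies the dominating function when a pairing with \<open>g\<close> is differentiated.\<close>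

lemma test_function_Lipschitz:
  fixes \<phi> :: "'a::euclidean_space \<Rightarrow> real"
  assumes t: "test_function \<phi>"
  obtains B where "B \<ge> 0" "\<And>x y. \<bar>\<phi> x - \<phi> y\<bar> \<le> B * norm (x - y)"
proof -
  obtain B where B: "B \<ge> 0" "\<And>x h. \<bar>frechet_derivative \<phi> (at x) h\<bar> \<le> B * norm h"
    using test_function_derivative_bounded[OF t] by blast
  have "norm (\<phi> x - \<phi> y) \<le> B * norm (x - y)" for x y
  proof (rule differentiable_bound[of UNIV])
    show "(\<phi> has_derivative frechet_derivative \<phi> (at x)) (at x within UNIV)" for x
      by (rule test_function_has_derivative[OF t])
    show "onorm (frechet_derivative \<phi> (at x)) \<le> B" for x
      by (rule onorm_bound) (use B in auto)
  qed auto
  then show ?thesis using B(1) that by simp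
qed

section \<open>Translates of functions of bounded variation\<close>

lemma lborel_integral_translate:
  fixes F :: "'a::euclidean_space \<Rightarrow> real"
  assumes [measurable]: "F \<in> borel_measurable borel"
  shows "(LINT x|lborel. F (x + c)) = (LINT x|lborel. F x)"
  by (subst (2) lborel_distr_plus[of c, symmetric], subst integral_distr) (auto simp: add.commute)

lemma lborel_integrable_translate:
  fixes F :: "'a::euclidean_space \<Rightarrow> real"
  assumes "integrable lborel F"
  shows "integrable lborel (\<lambda>x. F (x + c))"
proof -
  have [measurable]: "F \<in> borel_measurable borel" using borel_measurable_integrable[OF assms] by simp
  have "integrable (distr lborel borel ((+) c)) F"
    using assms by (simp add: lborel_distr_plus)
  then have "integrable lborel (\<lambda>x. F (c + x))"
    by (subst (asm) integrable_distr_eq) auto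
  then show ?thesis by (simp add: add.commute)
qed

text \<open>Isolates what the limit needs from a BV function. \<open>g\<close> stands for a Borel
  representative, so that maps such as \<open>g (x + y)\<close> are jointly Borel measurable and
  Tonelli applies; \<open>\<mu>\<close> and \<open>\<sigma>\<close> stand for the total variation of
  the gradient and a density of the gradient with respect to it.\<close>

locale gradient_density =
  fixes g :: "'a::euclidean_space \<Rightarrow> real" and \<mu> :: "'a measure" and \<sigma> :: "'a \<Rightarrow> 'a"
  assumes g_integrable: "integrable lborel g"
    and sets_mu: "sets \<mu> = sets borel"
    and finite_mu: "finite_measure \<mu>"
    and sigma_integrable: "integrable \<mu> \<sigma>"
    and partial_integration: "\<And>\<phi> b. test_function \<phi> \<Longrightarrow> b \<in> Basis \<Longrightarrow>
      (LINT x|lborel. g x * frechet_derivative \<phi> (at x) b) = - (LINT x|\<mu>. \<phi> x * (\<sigma> x \<bullet> b))"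
begin

lemma g_measurable [measurable]: "g \<in> borel_measurable borel"
  using borel_measurable_integrable[OF g_integrable] by simp

lemma sigma_measurable [measurable]: "\<sigma> \<in> borel_measurable borel"
  using borel_measurable_integrable[OF sigma_integrable] measurable_cong_sets[OF sets_mu refl] by blast

lemma borel_imp_mu_measurable: "h \<in> borel_measurable borel \<Longrightarrow> h \<in> borel_measurable \<mu>"
  using measurable_cong_sets[OF sets_mu refl] by blast

text \<open>The total mass of the directional derivative of \<open>g\<close> along \<open>y\<close>;
  this is \<open>V\<close> of the overview, and \<open>translation_distance\<close> below is
  \<open>D\<close>.\<close>

definition dir_variation :: "'a \<Rightarrow> real" where
  "dir_variation y = (LINT x|\<mu>. \<bar>\<sigma> x \<bullet> y\<bar>)"

definition translation_distance :: "'a \<Rightarrow> real" where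
  "translation_distance y = (LINT x|lborel. \<bar>g (x + y) - g x\<bar>)"

lemma g_mult_integrable:
  assumes [measurable]: "u \<in> borel_measurable borel" and "\<And>x. \<bar>u x\<bar> \<le> B"
  shows "integrable lborel (\<lambda>x. g x * u x)"
proof (rule Bochner_Integration.integrable_bound[OF integrable_mult_right[OF g_integrable, of B]])
  show "AE x in lborel. norm (g x * u x) \<le> norm (B * g x)"
  proof (rule AE_I2)
    fix x
    have "\<bar>g x\<bar> * \<bar>u x\<bar> \<le> \<bar>g x\<bar> * \<bar>B\<bar>" using assms(2)[of x] by (intro mult_left_mono) auto
    then show "norm (g x * u x) \<le> norm (B * g x)" by (simp add: abs_mult mult.commute)
  qed
qed auto

lemma sigma_mult_integrable:
  assumes [measurable]: "\<phi> \<in> borel_measurable borel" and "\<And>x. \<bar>\<phi> x\<bar> \<le> B"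
  shows "integrable \<mu> (\<lambda>x. \<phi> x * (\<sigma> x \<bullet> y))"
proof (rule Bochner_Integration.integrable_bound[OF integrable_mult_right[OF integrable_inner_left[OF sigma_integrable], of B y]])
  show "(\<lambda>x. \<phi> x * (\<sigma> x \<bullet> y)) \<in> borel_measurable \<mu>"
    by (rule borel_imp_mu_measurable) measurable
  show "AE x in \<mu>. norm (\<phi> x * (\<sigma> x \<bullet> y)) \<le> norm (B * (\<sigma> x \<bullet> y))"
  proof (rule AE_I2)
    fix x
    have "\<bar>\<phi> x\<bar> \<le> \<bar>B\<bar>" using assms(2)[of x] by auto
    then have "\<bar>\<phi> x\<bar> * \<bar>\<sigma> x \<bullet> y\<bar> \<le> \<bar>B\<bar> * \<bar>\<sigma> x \<bullet> y\<bar>" by (intro mult_right_mono) auto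
    then show "norm (\<phi> x * (\<sigma> x \<bullet> y)) \<le> norm (B * (\<sigma> x \<bullet> y))" by (simp add: abs_mult)
  qed
qed

lemma partial_integration_dir:
  assumes t: "test_function \<phi>"
  shows "(LINT x|lborel. g x * frechet_derivative \<phi> (at x) y) = - (LINT x|\<mu>. \<phi> x * (\<sigma> x \<bullet> y))"
proof -
  obtain B where B: "B \<ge> 0" "\<And>x h. \<bar>frechet_derivative \<phi> (at x) h\<bar> \<le> B * norm h"
    using test_function_derivative_bounded[OF t] by blast
  obtain B' where B': "\<And>x. \<bar>\<phi> x\<bar> \<le> B'"
    using test_function_bounded[OF t] by blast
  have i1: "integrable lborel (\<lambda>x. g x * frechet_derivative \<phi> (at x) b)" if "b \<in> Basis" for b
    by (rule g_mult_integrable[OF test_function_derivative_borel_measurable[OF t that] B(2)])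
  have i2: "integrable \<mu> (\<lambda>x. \<phi> x * (\<sigma> x \<bullet> b))" for b
    by (rule sigma_mult_integrable[OF test_function_imp_borel_measurable[OF t] B'])
  have "(LINT x|lborel. g x * frechet_derivative \<phi> (at x) y) =
      (LINT x|lborel. (\<Sum>b\<in>Basis. (y \<bullet> b) * (g x * frechet_derivative \<phi> (at x) b)))"
    by (subst test_function_derivative_sum[OF t]) (simp add: sum_distrib_left mult_ac)
  also have "\<dots> = (\<Sum>b\<in>Basis. (y \<bullet> b) * (LINT x|lborel. g x * frechet_derivative \<phi> (at x) b))"
    using i1 by (subst Bochner_Integration.integral_sum) auto
  also have "\<dots> = - (\<Sum>b\<in>Basis. (y \<bullet> b) * (LINT x|\<mu>. \<phi> x * (\<sigma> x \<bullet> b)))"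
    by (simp add: partial_integration[OF t] sum_negf)
  also have "(\<Sum>b\<in>Basis. (y \<bullet> b) * (LINT x|\<mu>. \<phi> x * (\<sigma> x \<bullet> b))) =
      (LINT x|\<mu>. (\<Sum>b\<in>Basis. (y \<bullet> b) * (\<phi> x * (\<sigma> x \<bullet> b))))"
    using i2 by (subst Bochner_Integration.integral_sum) auto
  also have "\<dots> = (LINT x|\<mu>. \<phi> x * (\<sigma> x \<bullet> y))"
    by (subst (2) euclidean_inner) (simp add: sum_distrib_left mult_ac)
  finally show ?thesis .
qed

text \<open>Dominated convergence along sequences: the difference quotients of \<open>\<phi>\<close>
  along \<open>y\<close> are bounded by its Lipschitz constant times \<open>norm y\<close>, and
  \<open>g\<close> is integrable. The minus sign from \<open>x - s *\<^sub>R y\<close> cancels the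
  one in the integration by parts.\<close>

lemma pairing_has_derivative_0:
  assumes t: "test_function \<phi>"
  shows "((\<lambda>s. LINT x|lborel. g x * \<phi> (x - s *\<^sub>R y)) has_real_derivative
    (LINT x|\<mu>. \<phi> x * (\<sigma> x \<bullet> y))) (at 0)"
proof -
  note [measurable] = test_function_imp_borel_measurable[OF t]
  obtain B where B: "B \<ge> 0" "\<And>x z. \<bar>\<phi> x - \<phi> z\<bar> \<le> B * norm (x - z)"
    using test_function_Lipschitz[OF t] by blast
  obtain B' where B': "\<And>x. \<bar>\<phi> x\<bar> \<le> B'"
    using test_function_bounded[OF t] by blast
  have i: "integrable lborel (\<lambda>x. g x * \<phi> (x - a))" for a
    using B' by (intro g_mult_integrable) auto
  have dir: "((\<lambda>h. (\<phi> (x - h *\<^sub>R y) - \<phi> x) / h) \<longlongrightarrow> - frechet_derivative \<phi> (at x) y) (at 0)" for x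
  proof -
    have 1: "((\<lambda>s. x - s *\<^sub>R y) has_derivative (\<lambda>s. - (s *\<^sub>R y))) (at 0)"
      by (auto intro!: derivative_eq_intros)
    have 2: "(\<phi> has_derivative frechet_derivative \<phi> (at x)) (at (x - 0 *\<^sub>R y))"
      using test_function_has_derivative[OF t] by simp
    have "((\<lambda>s. \<phi> (x - s *\<^sub>R y)) has_derivative (\<lambda>s. frechet_derivative \<phi> (at x) (- (s *\<^sub>R y)))) (at 0)"
      by (rule has_derivative_compose[OF 1 2])
    moreover have "frechet_derivative \<phi> (at x) (- (s *\<^sub>R y)) = - frechet_derivative \<phi> (at x) y * s" for s
    proof -
      interpret linear "frechet_derivative \<phi> (at x)"
        by (rule has_derivative_linear[OF test_function_has_derivative[OF t]])
      show ?thesis by (simp add: neg scale)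
    qed
    ultimately have "((\<lambda>s. \<phi> (x - s *\<^sub>R y)) has_real_derivative - frechet_derivative \<phi> (at x) y) (at 0)"
      by (simp only: has_field_derivative_def)
    then show ?thesis by (simp add: DERIV_def)
  qed
  have "((\<lambda>h. LINT x|lborel. g x * ((\<phi> (x - h *\<^sub>R y) - \<phi> x) / h)) \<longlongrightarrow>
      (LINT x|lborel. g x * - frechet_derivative \<phi> (at x) y)) (at 0)"
    unfolding tendsto_at_iff_sequentially comp_def
  proof safe
    fix X :: "nat \<Rightarrow> real" assume X: "\<forall>i. X i \<in> UNIV - {0}" "X \<longlonglongrightarrow> 0"
    show "(\<lambda>i. LINT x|lborel. g x * ((\<phi> (x - X i *\<^sub>R y) - \<phi> x) / X i)) \<longlonglongrightarrow>
      (LINT x|lborel. g x * - frechet_derivative \<phi> (at x) y)"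
    proof (rule integral_dominated_convergence)
      show "(\<lambda>x. g x * - frechet_derivative \<phi> (at x) y) \<in> borel_measurable lborel"
        using test_function_derivative_borel_measurable[OF t]
        by (subst test_function_derivative_sum[OF t]) measurable
      show "integrable lborel (\<lambda>x. (B * norm y) * \<bar>g x\<bar>)"
        using g_integrable by auto
      show "AE x in lborel. (\<lambda>i. g x * ((\<phi> (x - X i *\<^sub>R y) - \<phi> x) / X i)) \<longlonglongrightarrow> g x * - frechet_derivative \<phi> (at x) y"
      proof (rule AE_I2)
        fix x
        have "(\<lambda>i. (\<phi> (x - X i *\<^sub>R y) - \<phi> x) / X i) \<longlonglongrightarrow> - frechet_derivative \<phi> (at x) y"
          using dir[of x] X unfolding tendsto_at_iff_sequentially comp_def by blast
        then show "(\<lambda>i. g x * ((\<phi> (x - X i *\<^sub>R y) - \<phi> x) / X i)) \<longlonglongrightarrow> g x * - frechet_derivative \<phi> (at x) y"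
          by (intro tendsto_intros)
      qed
      show "AE x in lborel. norm (g x * ((\<phi> (x - X i *\<^sub>R y) - \<phi> x) / X i)) \<le> B * norm y * \<bar>g x\<bar>" for i
      proof (rule AE_I2)
        fix x
        have "X i \<noteq> 0" using X by auto
        have "\<bar>\<phi> (x - X i *\<^sub>R y) - \<phi> x\<bar> \<le> B * norm y * \<bar>X i\<bar>"
          using B(2)[of "x - X i *\<^sub>R y" x] by (simp add: mult_ac)
        then have "\<bar>(\<phi> (x - X i *\<^sub>R y) - \<phi> x) / X i\<bar> \<le> B * norm y"
          using \<open>X i \<noteq> 0\<close> by (simp add: divide_le_eq)
        then show "norm (g x * ((\<phi> (x - X i *\<^sub>R y) - \<phi> x) / X i)) \<le> B * norm y * \<bar>g x\<bar>"
          unfolding real_norm_def abs_mult by (subst mult.commute) (intro mult_right_mono, auto)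
      qed
    qed measurable
  qed
  moreover have "(LINT x|lborel. g x * - frechet_derivative \<phi> (at x) y) = (LINT x|\<mu>. \<phi> x * (\<sigma> x \<bullet> y))"
    using partial_integration_dir[OF t, of y] by simp
  moreover have "(LINT x|lborel. g x * ((\<phi> (x - h *\<^sub>R y) - \<phi> x) / h)) =
      ((LINT x|lborel. g x * \<phi> (x - (0 + h) *\<^sub>R y)) - (LINT x|lborel. g x * \<phi> (x - 0 *\<^sub>R y))) / h" for h
    using i[of "h *\<^sub>R y"] i[of 0]
    by (simp add: Bochner_Integration.integral_diff[symmetric] right_diff_distrib[symmetric])
  ultimately show ?thesis unfolding DERIV_def by (simp only:)
qed

text \<open>Translations form a one-parameter group, so the derivative at \<open>r\<close> is the
  derivative at 0 for a translated test function.\<close>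

lemma pairing_has_derivative:
  assumes t: "test_function \<phi>"
  shows "((\<lambda>s. LINT x|lborel. g x * \<phi> (x - s *\<^sub>R y)) has_real_derivative
    (LINT x|\<mu>. \<phi> (x - r *\<^sub>R y) * (\<sigma> x \<bullet> y))) (at r)"
proof -
  have "((\<lambda>s. LINT x|lborel. g x * \<phi> (x - s *\<^sub>R y - r *\<^sub>R y)) has_real_derivative
    (LINT x|\<mu>. \<phi> (x - r *\<^sub>R y) * (\<sigma> x \<bullet> y))) (at 0)"
    by (rule pairing_has_derivative_0[OF test_function_translate[OF t]])
  then show ?thesis
    using DERIV_shift[of "\<lambda>s. LINT x|lborel. g x * \<phi> (x - s *\<^sub>R y)" _ 0 r]
    by (simp add: algebra_simps)
qed

section \<open>Comparison of translates with the directional variation\<close>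

lemma sigma_inner_integrable: "integrable \<mu> (\<lambda>x. \<bar>\<sigma> x \<bullet> y\<bar>)"
  using integrable_inner_left[OF sigma_integrable, of y] by auto

lemma pairing_le_dir_variation:
  assumes t: "test_function \<phi>" and b: "\<And>x. \<bar>\<phi> x\<bar> \<le> 1"
  shows "(LINT x|\<mu>. \<phi> x * (\<sigma> x \<bullet> y)) \<le> dir_variation y"
  unfolding dir_variation_def
proof (rule integral_mono)
  show "integrable \<mu> (\<lambda>x. \<phi> x * (\<sigma> x \<bullet> y))"
    by (rule sigma_mult_integrable[OF test_function_imp_borel_measurable[OF t] b])
  show "\<phi> x * (\<sigma> x \<bullet> y) \<le> \<bar>\<sigma> x \<bullet> y\<bar>" for x
  proof -
    have "\<bar>\<phi> x * (\<sigma> x \<bullet> y)\<bar> \<le> \<bar>\<sigma> x \<bullet> y\<bar>"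
      using b[of x] by (simp add: abs_mult mult_left_le_one_le)
    then show ?thesis by linarith
  qed
qed (rule sigma_inner_integrable)

lemma difference_integrable: "integrable lborel (\<lambda>x. g (x + y) - g x)"
  using lborel_integrable_translate[OF g_integrable] g_integrable by auto

text \<open>Translation invariance of Lebesgue measure moves the shift from \<open>g\<close> to
  \<open>\<phi>\<close>, where it can be differentiated.\<close>

lemma difference_pairing:
  assumes t: "test_function \<phi>"
  shows "(LINT x|lborel. \<phi> x * (g (x + y) - g x)) =
     (LINT x|lborel. g x * \<phi> (x - y)) - (LINT x|lborel. g x * \<phi> x)"
proof -
  note [measurable] = test_function_imp_borel_measurable[OF t]
  obtain B' where B': "\<And>x. \<bar>\<phi> x\<bar> \<le> B'"
    using test_function_bounded[OF t] by blast
  have i: "integrable lborel (\<lambda>x. g x * \<phi> (x - a))" for a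
    using B' by (intro g_mult_integrable) auto
  have i': "integrable lborel (\<lambda>x. g (x + y) * \<phi> x)"
    using lborel_integrable_translate[OF i[of y], of y] by simp
  have "(LINT x|lborel. \<phi> x * (g (x + y) - g x)) = (LINT x|lborel. g (x + y) * \<phi> x - g x * \<phi> x)"
    by (simp add: algebra_simps)
  also have "\<dots> = (LINT x|lborel. g (x + y) * \<phi> x) - (LINT x|lborel. g x * \<phi> x)"
    using i' i[of 0] by (intro Bochner_Integration.integral_diff) auto
  also have "(LINT x|lborel. g (x + y) * \<phi> x) = (LINT x|lborel. g x * \<phi> (x - y))"
    using lborel_integral_translate[of "\<lambda>x. g x * \<phi> (x - y)" y] by simp
  finally show ?thesis .
qed

text \<open>Duality and the mean value theorem. A test function that nearly realises the L1 norm of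
  the difference turns it into an increment of the pairing over the parameters from 0 to 1. That
  increment is a derivative at some \<open>r\<close>, hence a pairing of the gradient with a
  translate still bounded by 1.\<close>

lemma translation_distance_le_dir_variation: "translation_distance y \<le> dir_variation y"
proof (rule field_le_epsilon)
  fix e :: real assume "e > 0"
  obtain \<phi> where \<phi>: "test_function \<phi>" "\<And>x. \<bar>\<phi> x\<bar> \<le> 1"
    "(LINT x|lborel. \<bar>g (x + y) - g x\<bar>) \<le> (LINT x|lborel. \<phi> x * (g (x + y) - g x)) + e"
    using test_function_sign_approx[of lborel, OF _ difference_integrable \<open>e > 0\<close>] by auto
  have "\<exists>r>0. r < 1 \<and> (LINT x|lborel. g x * \<phi> (x - 1 *\<^sub>R y)) - (LINT x|lborel. g x * \<phi> (x - 0 *\<^sub>R y)) =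
      (1 - 0) * (LINT x|\<mu>. \<phi> (x - r *\<^sub>R y) * (\<sigma> x \<bullet> y))"
    by (rule MVT2[OF zero_less_one pairing_has_derivative[OF \<phi>(1)]])
  then obtain r where r: "(LINT x|lborel. g x * \<phi> (x - y)) - (LINT x|lborel. g x * \<phi> x) =
      (LINT x|\<mu>. \<phi> (x - r *\<^sub>R y) * (\<sigma> x \<bullet> y))"
    by auto
  also have "\<dots> \<le> dir_variation y"
    using pairing_le_dir_variation[OF test_function_translate[OF \<phi>(1)]] \<phi>(2) by simp
  finally show "translation_distance y \<le> dir_variation y + e"
    using \<phi>(3) difference_pairing[OF \<phi>(1), of y] by (simp add: translation_distance_def)
qed

lemma translation_distance_nonneg: "translation_distance y \<ge> 0"
  by (simp add: translation_distance_def)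

lemma dir_variation_nonneg: "dir_variation y \<ge> 0"
  by (simp add: dir_variation_def)

lemma dir_variation_scaleR: "dir_variation (r *\<^sub>R y) = \<bar>r\<bar> * dir_variation y"
  by (simp add: dir_variation_def abs_mult)

text \<open>The upper bound is the preceding inequality with homogeneity. For the lower bound, a
  fixed test function nearly attains \<open>dir_variation y\<close>; its pairing quotients converge
  by differentiability at 0 and never exceed the quotient of the translation distance.\<close>

lemma translation_distance_quotient_tendsto:
  "((\<lambda>r. translation_distance (r *\<^sub>R y) / r) \<longlongrightarrow> dir_variation y) (at_right 0)"
proof (rule order_tendstoI)
  fix a assume a: "a < dir_variation y"
  \<comment> \<open>Half of the gap: the pairing then stays at or above the midpoint of
    \<open>a\<close> and \<open>dir_variation y\<close>, hence strictly above
    \<open>a\<close>.\<close>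
  define e where "e = (dir_variation y - a) / 2"
  have "e > 0" using a by (simp add: e_def)
  have i: "integrable \<mu> (\<lambda>x. \<sigma> x \<bullet> y)" by (rule integrable_inner_left[OF sigma_integrable])
  obtain \<phi> where \<phi>: "test_function \<phi>" "\<And>x. \<bar>\<phi> x\<bar> \<le> 1"
    "dir_variation y \<le> (LINT x|\<mu>. \<phi> x * (\<sigma> x \<bullet> y)) + e"
    using test_function_sign_approx[OF sets_mu i \<open>e > 0\<close>] by (auto simp: dir_variation_def)
  note [measurable] = test_function_imp_borel_measurable[OF \<phi>(1)]
  define H where "H s = (LINT x|lborel. g x * \<phi> (x - s *\<^sub>R y))" for s
  have "((\<lambda>h. (H (0 + h) - H 0) / h) \<longlongrightarrow> (LINT x|\<mu>. \<phi> x * (\<sigma> x \<bullet> y))) (at 0)"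
    using pairing_has_derivative_0[OF \<phi>(1), of y] unfolding DERIV_def H_def .
  then have "((\<lambda>h. (H h - H 0) / h) \<longlongrightarrow> (LINT x|\<mu>. \<phi> x * (\<sigma> x \<bullet> y))) (at_right 0)"
    by (simp add: filterlim_at_split)
  moreover have "a < (LINT x|\<mu>. \<phi> x * (\<sigma> x \<bullet> y))"
    using \<phi>(3) \<open>e > 0\<close> unfolding e_def by (simp add: field_simps)
  ultimately have "\<forall>\<^sub>F h in at_right 0. a < (H h - H 0) / h"
    by (rule order_tendstoD)
  then show "\<forall>\<^sub>F h in at_right 0. a < translation_distance (h *\<^sub>R y) / h"
    using eventually_at_right_less[of 0]
  proof eventually_elim
    case (elim h)
    have "H h - H 0 = (LINT x|lborel. \<phi> x * (g (x + h *\<^sub>R y) - g x))"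
      using difference_pairing[OF \<phi>(1), of "h *\<^sub>R y"] by (simp add: H_def)
    also have "\<dots> \<le> translation_distance (h *\<^sub>R y)"
      unfolding translation_distance_def
    proof (rule integral_mono)
      have *: "\<bar>\<phi> x * (g (x + h *\<^sub>R y) - g x)\<bar> \<le> \<bar>g (x + h *\<^sub>R y) - g x\<bar>" for x
        using \<phi>(2)[of x] by (simp add: abs_mult mult_left_le_one_le)
      then show "\<phi> x * (g (x + h *\<^sub>R y) - g x) \<le> \<bar>g (x + h *\<^sub>R y) - g x\<bar>" for x
        using abs_le_D1 by blast
      show "integrable lborel (\<lambda>x. \<phi> x * (g (x + h *\<^sub>R y) - g x))"
        by (rule Bochner_Integration.integrable_bound[OF difference_integrable[of "h *\<^sub>R y"]]) (use * in auto)
    qed (use difference_integrable in auto)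
    finally have "(H h - H 0) / h \<le> translation_distance (h *\<^sub>R y) / h"
      using elim(2) by (intro divide_right_mono) auto
    with elim show ?case by linarith
  qed
next
  fix a assume a: "dir_variation y < a"
  show "\<forall>\<^sub>F r in at_right 0. translation_distance (r *\<^sub>R y) / r < a"
    using eventually_at_right_less[of 0]
  proof eventually_elim
    case (elim r)
    have "translation_distance (r *\<^sub>R y) / r \<le> dir_variation y"
      using translation_distance_le_dir_variation[of "r *\<^sub>R y"] elim
      by (simp add: dir_variation_scaleR divide_le_eq mult.commute)
    with a show ?case by linarith
  qed
qed

end

section \<open>The limit of the fractional semi-norms\<close>

lemma nn_integral_powr_from_0:
  assumes "a > -1" "c \<ge> (0::real)"
  shows "(\<integral>\<^sup>+x. ennreal (x powr a) * indicator {0..c} x \<partial>lborel) = ennreal (c powr (a + 1) / (a + 1))"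
  by (rule nn_integral_has_integral_lebesgue'[OF _ has_integral_powr_from_0[OF assms]]) auto

lemma nn_integral_powr_to_inf:
  assumes "e < -1" "c > (0::real)"
  shows "(\<integral>\<^sup>+x. ennreal (x powr e) * indicator {c..} x \<partial>lborel) = ennreal (- (c powr (e + 1)) / (e + 1))"
  by (rule nn_integral_has_integral_lebesgue'[OF _ has_integral_powr_to_inf[OF assms]]) auto

text \<open>As \<open>\<alpha>\<close> tends to 1, the weight \<open>(1 - \<alpha>) r powr (-\<alpha>)\<close> concentrates at the origin, so that only
  the behaviour of \<open>G r / r\<close> near zero survives.\<close>

lemma concentration_limit:
  fixes G :: "real \<Rightarrow> ennreal" and d w C :: real
  assumes [measurable]: "G \<in> borel_measurable borel"
    and d: "d \<ge> 0" and w: "w \<ge> 0" and C: "C \<ge> 0"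
    and Gw: "\<And>r. r > 0 \<Longrightarrow> G r \<le> ennreal (r * w)"
    and GC: "\<And>r. r > 0 \<Longrightarrow> G r \<le> ennreal C"
    and Glow: "\<And>a. a < w \<Longrightarrow> \<forall>\<^sub>F r in at_right 0. ennreal (r * a) \<le> G r"
  shows "((\<lambda>\<alpha>. ennreal (1 - \<alpha>) *
      (\<integral>\<^sup>+r. ennreal ((d + \<alpha>) * r powr (- \<alpha> - 1)) * G r * indicator {0<..} r \<partial>lborel))
    \<longlongrightarrow> ennreal ((d + 1) * w)) (at_left 1)" (is "((\<lambda>\<alpha>. ennreal (1 - \<alpha>) * ?I \<alpha>) \<longlongrightarrow> _) _")
proof (rule order_tendstoI)
  have ev: "\<forall>\<^sub>F \<alpha> in at_left 1. 0 < \<alpha> \<and> \<alpha> < (1::real)"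
    unfolding eventually_at_left_field by (intro exI[of _ 0]) auto
  fix u assume u: "ennreal ((d + 1) * w) < u"
  have upper: "ennreal (1 - \<alpha>) * ?I \<alpha> \<le> ennreal ((d + \<alpha>) * (w + (1 - \<alpha>) * C / \<alpha>))"
    if \<alpha>: "0 < \<alpha>" "\<alpha> < 1" for \<alpha>
  proof -
    \<comment> \<open>The integral is split at \<open>r = 1\<close>. The linear bound contributes
      \<open>w / (1 - \<alpha>)\<close>, the constant bound \<open>C / \<alpha>\<close>; after
      multiplication by \<open>1 - \<alpha>\<close> only the first survives the limit.\<close>
    have "?I \<alpha> \<le> (\<integral>\<^sup>+r. ennreal ((d + \<alpha>) * w) * (ennreal (r powr (- \<alpha>)) * indicator {0..1} r) +
        ennreal ((d + \<alpha>) * C) * (ennreal (r powr (- \<alpha> - 1)) * indicator {1..} r) \<partial>lborel)"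
    proof (rule nn_integral_mono)
      fix r :: real
      consider "r \<le> 0" | "0 < r" "r \<le> 1" | "r > 1" by linarith
      then show "ennreal ((d + \<alpha>) * r powr (- \<alpha> - 1)) * G r * indicator {0<..} r \<le>
        ennreal ((d + \<alpha>) * w) * (ennreal (r powr (- \<alpha>)) * indicator {0..1} r) +
        ennreal ((d + \<alpha>) * C) * (ennreal (r powr (- \<alpha> - 1)) * indicator {1..} r)"
      proof cases
        case 2
        have "ennreal ((d + \<alpha>) * r powr (- \<alpha> - 1)) * G r \<le>
            ennreal ((d + \<alpha>) * r powr (- \<alpha> - 1)) * ennreal (r * w)"
          by (intro mult_left_mono Gw 2) auto
        also have "\<dots> = ennreal ((d + \<alpha>) * w) * ennreal (r powr (- \<alpha>))"
          using 2 w d \<alpha> by (simp add: ennreal_mult'[symmetric] powr_diff mult_ac)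
        finally show ?thesis using 2 by (auto simp: add_increasing2)
      next
        case 3
        have "ennreal ((d + \<alpha>) * r powr (- \<alpha> - 1)) * G r \<le>
            ennreal ((d + \<alpha>) * r powr (- \<alpha> - 1)) * ennreal C"
          using 3 by (intro mult_left_mono GC) auto
        also have "\<dots> = ennreal ((d + \<alpha>) * C) * ennreal (r powr (- \<alpha> - 1))"
          using C d \<alpha> by (simp add: ennreal_mult[symmetric] mult_ac)
        finally show ?thesis using 3 by auto
      qed auto
    qed
    also have "\<dots> = ennreal ((d + \<alpha>) * w) * ennreal (1 / (1 - \<alpha>)) + ennreal ((d + \<alpha>) * C) * ennreal (1 / \<alpha>)"
      using nn_integral_powr_from_0[of "-\<alpha>" 1] nn_integral_powr_to_inf[of "- \<alpha> - 1" 1] \<alpha>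
      by (simp add: nn_integral_add nn_integral_cmult)
    also have "\<dots> = ennreal ((d + \<alpha>) * (w / (1 - \<alpha>) + C / \<alpha>))"
      using \<alpha> d w C by (simp add: ennreal_mult[symmetric] ennreal_plus[symmetric] field_simps del: ennreal_plus)
    finally have "ennreal (1 - \<alpha>) * ?I \<alpha> \<le> ennreal (1 - \<alpha>) * ennreal ((d + \<alpha>) * (w / (1 - \<alpha>) + C / \<alpha>))"
      by (intro mult_left_mono) auto
    also have "\<dots> = ennreal ((1 - \<alpha>) * ((d + \<alpha>) * (w / (1 - \<alpha>) + C / \<alpha>)))"
      using \<alpha> d w C by (simp add: ennreal_mult)
    also have "(1 - \<alpha>) * ((d + \<alpha>) * (w / (1 - \<alpha>) + C / \<alpha>)) = (d + \<alpha>) * (w + (1 - \<alpha>) * C / \<alpha>)"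
      using \<alpha> by (simp add: field_simps)
    finally show ?thesis .
  qed
  have "((\<lambda>\<alpha>. (d + \<alpha>) * (w + (1 - \<alpha>) * C / \<alpha>)) \<longlongrightarrow> (d + 1) * (w + (1 - 1) * C / 1)) (at_left 1)"
    by (intro tendsto_intros) auto
  then have "((\<lambda>\<alpha>. ennreal ((d + \<alpha>) * (w + (1 - \<alpha>) * C / \<alpha>))) \<longlongrightarrow> ennreal ((d + 1) * w)) (at_left 1)"
    by (intro tendsto_ennrealI) simp
  then have "\<forall>\<^sub>F \<alpha> in at_left 1. ennreal ((d + \<alpha>) * (w + (1 - \<alpha>) * C / \<alpha>)) < u"
    by (rule order_tendstoD(2)[OF _ u])
  with ev show "\<forall>\<^sub>F \<alpha> in at_left 1. ennreal (1 - \<alpha>) * ?I \<alpha> < u"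
    by eventually_elim (use upper in \<open>auto intro: le_less_trans\<close>)
next
  have ev: "\<forall>\<^sub>F \<alpha> in at_left 1. 0 < \<alpha> \<and> \<alpha> < (1::real)"
    unfolding eventually_at_left_field by (intro exI[of _ 0]) auto
  fix l assume l: "l < ennreal ((d + 1) * w)"
  then obtain l' where l': "l = ennreal l'" "l' \<ge> 0" by (cases l) auto
  then have "l' < (d + 1) * w" using l by (simp add: ennreal_less_iff)
  define c where "c = l' / (d + 1)"
  \<comment> \<open>The midpoint leaves strict room on both sides: \<open>a < w\<close> makes
    \<open>Glow\<close> applicable, and \<open>c < a\<close> keeps \<open>(d + 1) * a\<close> above
    \<open>l'\<close>.\<close>
  define a where "a = (c + w) / 2"
  have "c < w" using \<open>l' < (d + 1) * w\<close> d by (simp add: c_def field_simps)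
  then have a: "c < a" "a < w" by (auto simp: a_def)
  have "0 \<le> c" using d l'(2) by (simp add: c_def)
  with a have a0: "a \<ge> 0" by linarith
  have la: "l' < (d + 1) * a" using a(1) d by (simp add: c_def field_simps)
  obtain \<delta> where \<delta>: "\<delta> > 0" "\<And>r. 0 < r \<Longrightarrow> r < \<delta> \<Longrightarrow> ennreal (r * a) \<le> G r"
    using Glow[OF a(2)] unfolding eventually_at_right_field by auto
  \<comment> \<open>Halving \<open>\<delta>\<close> makes the bound valid up to and including the
    endpoint, matching the closed interval of integration.\<close>
  define \<eta> where "\<eta> = \<delta> / 2"
  have \<eta>: "\<eta> > 0" "\<And>r. 0 < r \<Longrightarrow> r \<le> \<eta> \<Longrightarrow> ennreal (r * a) \<le> G r"
    using \<delta> by (auto simp: \<eta>_def)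
  have lower: "ennreal ((d + \<alpha>) * a * \<eta> powr (1 - \<alpha>)) \<le> ennreal (1 - \<alpha>) * ?I \<alpha>"
    if \<alpha>: "0 < \<alpha>" "\<alpha> < 1" for \<alpha>
  proof -
    have "ennreal ((d + \<alpha>) * a) * ennreal (\<eta> powr (1 - \<alpha>) / (1 - \<alpha>)) =
        (\<integral>\<^sup>+r. ennreal ((d + \<alpha>) * a) * (ennreal (r powr (- \<alpha>)) * indicator {0..\<eta>} r) \<partial>lborel)"
      using nn_integral_powr_from_0[of "-\<alpha>" \<eta>] \<alpha> \<eta>(1) by (simp add: nn_integral_cmult)
    also have "\<dots> \<le> ?I \<alpha>"
    proof (rule nn_integral_mono)
      fix r :: real
      show "ennreal ((d + \<alpha>) * a) * (ennreal (r powr (- \<alpha>)) * indicator {0..\<eta>} r) \<le>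
        ennreal ((d + \<alpha>) * r powr (- \<alpha> - 1)) * G r * indicator {0<..} r"
      proof (cases "0 < r \<and> r \<le> \<eta>")
        case True
        have "ennreal ((d + \<alpha>) * a) * ennreal (r powr (- \<alpha>)) =
            ennreal ((d + \<alpha>) * r powr (- \<alpha> - 1)) * ennreal (r * a)"
          using True a0 d \<alpha> by (simp add: ennreal_mult'[symmetric] powr_diff mult_ac)
        also have "\<dots> \<le> ennreal ((d + \<alpha>) * r powr (- \<alpha> - 1)) * G r"
          using True \<eta>(2) by (intro mult_left_mono) auto
        finally show ?thesis using True by auto
      qed (auto split: split_indicator)
    qed
    finally have "ennreal (1 - \<alpha>) * (ennreal ((d + \<alpha>) * a) * ennreal (\<eta> powr (1 - \<alpha>) / (1 - \<alpha>))) \<le>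
        ennreal (1 - \<alpha>) * ?I \<alpha>"
      by (intro mult_left_mono) auto
    moreover have "ennreal (1 - \<alpha>) * (ennreal ((d + \<alpha>) * a) * ennreal (\<eta> powr (1 - \<alpha>) / (1 - \<alpha>))) =
        ennreal ((d + \<alpha>) * a * \<eta> powr (1 - \<alpha>))"
      using \<alpha> d a0 by (simp add: ennreal_mult[symmetric])
    ultimately show ?thesis by simp
  qed
  \<comment> \<open>However small \<open>\<eta>\<close> is,
    \<open>\<eta> powr (1 - \<alpha>)\<close> tends to 1; this is the concentration at the
    origin.\<close>
  have "((\<lambda>\<alpha>. (d + \<alpha>) * a * \<eta> powr (1 - \<alpha>)) \<longlongrightarrow> (d + 1) * a * \<eta> powr (1 - 1)) (at_left 1)"
    using \<eta>(1) by (intro tendsto_intros) auto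
  then have "((\<lambda>\<alpha>. ennreal ((d + \<alpha>) * a * \<eta> powr (1 - \<alpha>))) \<longlongrightarrow> ennreal ((d + 1) * a)) (at_left 1)"
    using \<eta>(1) by (intro tendsto_ennrealI) simp
  moreover have "l < ennreal ((d + 1) * a)" using la l' by (simp add: ennreal_less_iff)
  ultimately have "\<forall>\<^sub>F \<alpha> in at_left 1. l < ennreal ((d + \<alpha>) * a * \<eta> powr (1 - \<alpha>))"
    by (rule order_tendstoD(1))
  with ev show "\<forall>\<^sub>F \<alpha> in at_left 1. l < ennreal (1 - \<alpha>) * ?I \<alpha>"
    by eventually_elim (use lower in \<open>auto intro: less_le_trans\<close>)
qed

section \<open>Dilations, the gauge of a convex body and the kernel\<close>

lemma nn_integral_lborel_scaleR:
  fixes F :: "'a::euclidean_space \<Rightarrow> ennreal"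
  assumes [measurable]: "F \<in> borel_measurable borel" and "r > 0"
  shows "(\<integral>\<^sup>+y. F y \<partial>lborel) = ennreal (r ^ DIM('a)) * (\<integral>\<^sup>+z. F (r *\<^sub>R z) \<partial>lborel)"
  using assms(2)
  by (subst lborel_affine[of r 0])
     (auto simp: nn_integral_density nn_integral_distr nn_integral_cmult)

lemma body_norm_le_iff:
  fixes K :: "'a::euclidean_space set"
  assumes K: "compact K" "convex K" and 0: "0 \<in> interior K" and r: "r > 0"
  shows "body_norm K y \<le> r \<longleftrightarrow> inverse r *\<^sub>R y \<in> K"
proof
  let ?A = "{l. l > 0 \<and> inverse l *\<^sub>R y \<in> K}"
  have bdd: "bdd_below ?A" by (rule bdd_belowI[of _ 0]) auto
  assume "inverse r *\<^sub>R y \<in> K"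
  then show "body_norm K y \<le> r" unfolding body_norm_def using r bdd by (intro cInf_lower) auto
next
  have K0: "0 \<in> K" using 0 interior_subset by blast
  let ?A = "{l. l > 0 \<and> inverse l *\<^sub>R y \<in> K}"
  have bdd: "bdd_below ?A" by (rule bdd_belowI[of _ 0]) auto
  have mono: "inverse m *\<^sub>R y \<in> K" if "l \<in> ?A" "l \<le> m" for l m
  proof -
    have "(l / m) *\<^sub>R (inverse l *\<^sub>R y) + (1 - l / m) *\<^sub>R 0 \<in> K"
      using that K0 by (intro convexD[OF K(2)]) auto
    moreover have "l / m * inverse l = inverse m" using that by (simp add: field_simps)
    ultimately show ?thesis by simp
  qed
  have ne: "?A \<noteq> {}"
  proof -
    obtain e where e: "e > 0" "ball 0 e \<subseteq> K" using 0 by (meson mem_interior)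
    \<comment> \<open>The summand 1 keeps \<open>l\<close> positive when \<open>y = 0\<close> and
      makes \<open>norm y / l < e\<close> strict.\<close>
    define l where "l = (norm y + 1) / e"
    have "l > 0" using e by (simp add: l_def add_nonneg_pos)
    moreover have "e * l = norm y + 1" using e by (simp add: l_def)
    then have "norm y / l < e" using \<open>l > 0\<close> by (simp add: pos_divide_less_eq)
    then have "inverse l *\<^sub>R y \<in> ball 0 e" using \<open>l > 0\<close> by (simp add: field_simps)
    ultimately have "l \<in> ?A" using e by blast
    then show ?thesis by blast
  qed
  assume le: "body_norm K y \<le> r"
  have "inverse (r + inverse (real (Suc n))) *\<^sub>R y \<in> K" for n
  proof -
    have "Inf ?A < r + inverse (real (Suc n))" using le unfolding body_norm_def
      by (smt (verit) inverse_positive_iff_positive of_nat_0_less_iff zero_less_Suc)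
    then obtain l where l: "l \<in> ?A" "l < r + inverse (real (Suc n))"
      using cInf_lessD[OF ne] by blast
    show ?thesis by (rule mono[OF l(1) less_imp_le[OF l(2)]])
  qed
  moreover have "(\<lambda>n. inverse (r + inverse (real (Suc n))) *\<^sub>R y) \<longlonglongrightarrow> inverse (r + 0) *\<^sub>R y"
    using r by (intro tendsto_intros LIMSEQ_inverse_real_of_nat) auto
  ultimately have "inverse (r + 0) *\<^sub>R y \<in> K"
    by (rule closed_sequentially[OF compact_imp_closed[OF K(1)]])
  then show "inverse r *\<^sub>R y \<in> K" by simp
qed

lemma body_norm_pos:
  fixes K :: "'a::euclidean_space set"
  assumes K: "compact K" "convex K" and 0: "0 \<in> interior K" and y: "y \<noteq> 0"
  shows "body_norm K y > 0"
proof (rule ccontr)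
  assume "\<not> body_norm K y > 0"
  then have *: "inverse r *\<^sub>R y \<in> K" if "r > 0" for r
    using body_norm_le_iff[OF K 0 that, of y] that by simp
  obtain B where B: "B > 0" "\<And>x. x \<in> K \<Longrightarrow> norm x \<le> B"
    using compact_imp_bounded[OF K(1)] bounded_pos by blast
  \<comment> \<open>With this factor the dilated point has norm \<open>2 * B\<close>, beyond the
    bound \<open>B\<close> on \<open>K\<close>.\<close>
  have "norm (inverse (norm y / (2 * B)) *\<^sub>R y) \<le> B"
    by (rule B(2), rule *) (use B y in auto)
  then show False using B(1) y by (simp add: field_simps)
qed

text \<open>The origin is the midpoint of an interior point and its reflection.\<close>

lemma origin_symmetric_interior:
  fixes K :: "'a::euclidean_space set"
  assumes "convex_body K" "origin_symmetric K"
  shows "0 \<in> interior K"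
proof -
  have K: "convex K" "interior K \<noteq> {}" "uminus ` K = K"
    using assms by (auto simp: convex_body_def origin_symmetric_def)
  then obtain x where x: "x \<in> interior K" by auto
  have "uminus ` interior K = interior (uminus ` K)"
    by (rule interior_negations[symmetric])
  then have "- x \<in> interior K" using x K by auto
  then have "(1/2) *\<^sub>R x + (1/2) *\<^sub>R (- x) \<in> interior K"
    using x by (intro convexD[OF convex_interior[OF K(1)]]) auto
  then show ?thesis by simp
qed

lemma integrable_inner_on_compact:
  fixes K :: "'a::euclidean_space set"
  assumes "compact K"
  shows "integrable lborel (\<lambda>x. indicator K x * \<bar>y \<bullet> x\<bar>)"
proof -
  have "continuous_on K (\<lambda>z. \<bar>y \<bullet> z\<bar>)" by (intro continuous_intros)
  then show ?thesis
    using borel_integrable_compact[OF assms, of "\<lambda>z. \<bar>y \<bullet> z\<bar>"]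
    by (simp add: indicator_def if_distrib cong: if_cong)
qed

text \<open>The tail integral of \<open>p * r powr (- p - 1)\<close> from n to infinity is n to the
  power \<open>- p\<close>, and the values \<open>r \<ge> body_norm K y\<close> are exactly the
  positive \<open>r\<close> for which \<open>y\<close> lies in the dilate of \<open>K\<close> by
  \<open>r\<close>. The kernel is thus a superposition of indicators of dilates.\<close>

lemma kernel_layer_cake:
  fixes K :: "'a::euclidean_space set"
  assumes K: "compact K" "convex K" "0 \<in> interior K" and y: "y \<noteq> 0" and p: "p > 0"
  shows "ennreal (1 / body_norm K y powr p) =
    (\<integral>\<^sup>+r. ennreal (p * r powr (- p - 1)) * indicator {0<..} r * indicator K (inverse r *\<^sub>R y) \<partial>lborel)"
proof -
  let ?n = "body_norm K y"
  have n: "?n > 0" by (rule body_norm_pos[OF K y])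
  have ind: "indicator {0<..} r * indicator K (inverse r *\<^sub>R y) = (indicator {?n..} r :: ennreal)" for r
    using body_norm_le_iff[OF K, of r y] n by (auto split: split_indicator)
  have "(\<integral>\<^sup>+r. ennreal (p * r powr (- p - 1)) * indicator {0<..} r * indicator K (inverse r *\<^sub>R y) \<partial>lborel) =
      (\<integral>\<^sup>+r. ennreal p * (ennreal (r powr (- p - 1)) * indicator {?n..} r) \<partial>lborel)"
    unfolding mult.assoc ind using p by (simp add: ennreal_mult mult.assoc)
  also have "\<dots> = ennreal p * ennreal (?n powr (- p) / p)"
    using nn_integral_powr_to_inf[of "- p - 1" ?n] n p by (simp add: nn_integral_cmult)
  also have "\<dots> = ennreal (1 / ?n powr p)"
    using p n by (simp add: ennreal_mult[symmetric] powr_minus_divide)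
  finally show ?thesis by simp
qed

section \<open>Averages over the body and the limit of the double integral\<close>

context gradient_density
begin

lemma nn_integral_difference:
  "(\<integral>\<^sup>+x. ennreal \<bar>g (x + y) - g x\<bar> \<partial>lborel) = ennreal (translation_distance y)"
  unfolding translation_distance_def
  using difference_integrable by (intro nn_integral_eq_integral) auto

lemma translation_distance_measurable [measurable]: "translation_distance \<in> borel_measurable borel"
  unfolding translation_distance_def by measurable

lemma dir_variation_measurable [measurable]: "dir_variation \<in> borel_measurable borel"
proof -
  interpret finite_measure \<mu> by (rule finite_mu)
  have "(\<lambda>(y, x). \<bar>\<sigma> x \<bullet> y\<bar>) \<in> borel_measurable (borel \<Otimes>\<^sub>M borel)" by measurable
  then have "(\<lambda>(y, x). \<bar>\<sigma> x \<bullet> y\<bar>) \<in> borel_measurable (borel \<Otimes>\<^sub>M \<mu>)"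
    by (simp add: measurable_cong_sets[OF sets_pair_measure_cong[OF refl sets_mu] refl])
  then show ?thesis unfolding dir_variation_def by (rule borel_measurable_lebesgue_integral)
qed

lemma dir_variation_le: "dir_variation y \<le> (LINT x|\<mu>. norm (\<sigma> x)) * norm y"
proof -
  have "dir_variation y \<le> (LINT x|\<mu>. norm (\<sigma> x) * norm y)"
    unfolding dir_variation_def
    using sigma_integrable by (intro integral_mono sigma_inner_integrable) (auto intro: Cauchy_Schwarz_ineq2)
  then show ?thesis by simp
qed

text \<open>Meant for large displacements, where the linear bound by \<open>dir_variation\<close>
  would give a divergent tail for \<alpha> < 1.\<close>

lemma translation_distance_le_L1: "translation_distance y \<le> 2 * (LINT x|lborel. \<bar>g x\<bar>)"
proof -
  have i: "integrable lborel (\<lambda>x. \<bar>g x\<bar>)" using g_integrable by auto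
  have "translation_distance y \<le> (LINT x|lborel. \<bar>g (x + y)\<bar> + \<bar>g x\<bar>)"
    unfolding translation_distance_def
    using difference_integrable[of y] i lborel_integrable_translate[OF i, of y]
    by (intro integral_mono) auto
  also have "\<dots> = (LINT x|lborel. \<bar>g (x + y)\<bar>) + (LINT x|lborel. \<bar>g x\<bar>)"
    using i lborel_integrable_translate[OF i, of y] by simp
  also have "(LINT x|lborel. \<bar>g (x + y)\<bar>) = (LINT x|lborel. \<bar>g x\<bar>)"
    by (rule lborel_integral_translate) measurable
  finally show ?thesis by simp
qed

lemma dir_variation_integrable_on_compact:
  assumes "compact K"
  shows "integrable lborel (\<lambda>z. indicator K z * dir_variation z)"
proof -
  obtain B where B: "B > 0" "\<And>x. x \<in> K \<Longrightarrow> norm x \<le> B"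
    using compact_imp_bounded[OF assms] bounded_pos by blast
  have [measurable]: "K \<in> sets borel" using assms by (rule borel_compact)
  let ?c = "(LINT x|\<mu>. norm (\<sigma> x)) * B"
  have "integrable lborel (\<lambda>z. indicator K z * ?c)"
    using emeasure_compact_finite[OF assms] by (intro integrable_mult_left integrable_real_indicator) auto
  then show ?thesis
  proof (rule Bochner_Integration.integrable_bound)
    show "AE z in lborel. norm (indicator K z * dir_variation z) \<le> norm (indicator K z * ?c)"
    proof (rule AE_I2)
      fix z
      have "dir_variation z \<le> ?c" if "z \<in> K"
        by (rule order_trans[OF dir_variation_le mult_left_mono[OF B(2)[OF that]]]) simp
      then show "norm (indicator K z * dir_variation z) \<le> norm (indicator K z * ?c)"
        using dir_variation_nonneg[of z] by (auto split: split_indicator)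
    qed
  qed measurable
qed

lemma translation_distance_integrable_on_compact:
  assumes "compact K"
  shows "integrable lborel (\<lambda>z. indicator K z * translation_distance (r *\<^sub>R z))"
proof -
  have [measurable]: "K \<in> sets borel" using assms by (rule borel_compact)
  show ?thesis
  proof (rule Bochner_Integration.integrable_bound[OF integrable_mult_right[OF dir_variation_integrable_on_compact[OF assms], of "\<bar>r\<bar>"]])
    show "AE z in lborel. norm (indicator K z * translation_distance (r *\<^sub>R z)) \<le>
        norm (\<bar>r\<bar> * (indicator K z * dir_variation z))"
      using translation_distance_le_dir_variation[of "r *\<^sub>R _"] translation_distance_nonneg[of "r *\<^sub>R _"]
      by (intro AE_I2) (auto simp: dir_variation_scaleR abs_mult dir_variation_nonneg split: split_indicator)
  qed measurable
qed

text \<open>Dominated convergence with \<open>dir_variation\<close> as the dominating function,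
  since it bounds the quotient for every positive \<open>r\<close>, not only in the limit.\<close>

lemma averaged_translation_quotient_tendsto:
  assumes K: "compact K"
  shows "((\<lambda>r. (LINT z|lborel. indicator K z * translation_distance (r *\<^sub>R z)) / r) \<longlongrightarrow>
    (LINT z|lborel. indicator K z * dir_variation z)) (at_right 0)"
  unfolding tendsto_at_iff_sequentially comp_def
proof safe
  have [measurable]: "K \<in> sets borel" using K by (rule borel_compact)
  fix X :: "nat \<Rightarrow> real" assume X: "\<forall>i. X i \<in> {0<..} - {0}" "X \<longlonglongrightarrow> 0"
  have "(\<lambda>i. LINT z|lborel. indicator K z * (translation_distance (X i *\<^sub>R z) / X i)) \<longlonglongrightarrow>
    (LINT z|lborel. indicator K z * dir_variation z)"
  proof (rule integral_dominated_convergence[OF _ _ dir_variation_integrable_on_compact[OF K]])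
    show "AE z in lborel. (\<lambda>i. indicator K z * (translation_distance (X i *\<^sub>R z) / X i)) \<longlonglongrightarrow> indicator K z * dir_variation z"
    proof (rule AE_I2)
      fix z
      have "(\<lambda>i. translation_distance (X i *\<^sub>R z) / X i) \<longlonglongrightarrow> dir_variation z"
        using translation_distance_quotient_tendsto[of z] X unfolding tendsto_at_iff_sequentially comp_def by blast
      then show "(\<lambda>i. indicator K z * (translation_distance (X i *\<^sub>R z) / X i)) \<longlonglongrightarrow> indicator K z * dir_variation z"
        by (intro tendsto_intros)
    qed
    show "AE z in lborel. norm (indicator K z * (translation_distance (X i *\<^sub>R z) / X i)) \<le> indicator K z * dir_variation z" for i
    proof (rule AE_I2)
      fix z
      have "X i > 0" using X by auto
      then have "translation_distance (X i *\<^sub>R z) / X i \<le> dir_variation z"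
        using translation_distance_le_dir_variation[of "X i *\<^sub>R z"]
        by (simp add: dir_variation_scaleR divide_le_eq mult.commute)
      then show "norm (indicator K z * (translation_distance (X i *\<^sub>R z) / X i)) \<le> indicator K z * dir_variation z"
        using \<open>X i > 0\<close> translation_distance_nonneg[of "X i *\<^sub>R z"] by (auto split: split_indicator)
    qed
  qed measurable
  then show "(\<lambda>i. (LINT z|lborel. indicator K z * translation_distance (X i *\<^sub>R z)) / X i) \<longlonglongrightarrow>
    (LINT z|lborel. indicator K z * dir_variation z)"
    by simp
qed

text \<open>Two applications of Tonelli: integrating over \<open>x\<close> first produces the
  translation distance, and moving \<open>r\<close> outside leaves an integral over a dilate of
  \<open>K\<close>, which is rescaled to \<open>K\<close>.\<close>

lemma fractional_seminorm_layer_cake: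
  fixes K :: "'a set"
  assumes K: "compact K" "convex K" "0 \<in> interior K" and \<alpha>: "\<alpha> > 0"
  shows "(\<integral>\<^sup>+x. (\<integral>\<^sup>+y. ennreal (\<bar>g (x + y) - g x\<bar> / body_norm K y powr (real DIM('a) + \<alpha>)) \<partial>lborel) \<partial>lborel) =
    (\<integral>\<^sup>+r. ennreal ((real DIM('a) + \<alpha>) * r powr (- \<alpha> - 1)) *
       (\<integral>\<^sup>+z. ennreal (translation_distance (r *\<^sub>R z)) * indicator K z \<partial>lborel) * indicator {0<..} r \<partial>lborel)"
proof -
  let ?p = "real DIM('a) + \<alpha>"
  have [measurable]: "K \<in> sets borel" using K(1) by (rule borel_compact)
  let ?q = "\<lambda>r. ennreal (?p * r powr (- ?p - 1)) * indicator {0<..} r"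
  define k where "k y = (\<integral>\<^sup>+r. ?q r * indicator K (inverse r *\<^sub>R y) \<partial>lborel)" for y :: 'a
  have [measurable]: "k \<in> borel_measurable borel" unfolding k_def by measurable
  \<comment> \<open>The layer-cake formula requires a nonzero vector; the origin is a null
    set.\<close>
  have ne0: "AE y in lborel. y \<noteq> (0::'a)" by (rule AE_lborel_singleton)
  have "(\<integral>\<^sup>+x. (\<integral>\<^sup>+y. ennreal (\<bar>g (x + y) - g x\<bar> / body_norm K y powr ?p) \<partial>lborel) \<partial>lborel) =
      (\<integral>\<^sup>+x. (\<integral>\<^sup>+y. ennreal \<bar>g (x + y) - g x\<bar> * k y \<partial>lborel) \<partial>lborel)"
  proof (rule nn_integral_cong, rule nn_integral_cong_AE)
    fix x :: 'a
    show "AE y in lborel. ennreal (\<bar>g (x + y) - g x\<bar> / body_norm K y powr ?p) = ennreal \<bar>g (x + y) - g x\<bar> * k y"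
      using ne0
    proof eventually_elim
      case (elim y)
      have "k y = ennreal (1 / body_norm K y powr ?p)"
        unfolding k_def using \<alpha> by (intro kernel_layer_cake[symmetric] K elim) (simp add: add_nonneg_pos)
      then show ?case by (simp add: ennreal_mult[symmetric])
    qed
  qed
  also have "\<dots> = (\<integral>\<^sup>+y. (\<integral>\<^sup>+x. ennreal \<bar>g (x + y) - g x\<bar> * k y \<partial>lborel) \<partial>lborel)"
    by (rule lborel_pair.Fubini') measurable
  also have "\<dots> = (\<integral>\<^sup>+y. ennreal (translation_distance y) * k y \<partial>lborel)"
    by (simp add: nn_integral_multc nn_integral_difference)
  also have "\<dots> = (\<integral>\<^sup>+y. (\<integral>\<^sup>+r. ?q r * (ennreal (translation_distance y) * indicator K (inverse r *\<^sub>R y)) \<partial>lborel) \<partial>lborel)"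
    unfolding k_def by (subst nn_integral_cmult[symmetric]) (auto simp: mult_ac)
  also have "\<dots> = (\<integral>\<^sup>+r. (\<integral>\<^sup>+y. ?q r * (ennreal (translation_distance y) * indicator K (inverse r *\<^sub>R y)) \<partial>lborel) \<partial>lborel)"
    by (rule lborel_pair.Fubini') measurable
  also have "\<dots> = (\<integral>\<^sup>+r. ?q r * (\<integral>\<^sup>+y. ennreal (translation_distance y) * indicator K (inverse r *\<^sub>R y) \<partial>lborel) \<partial>lborel)"
    by (subst nn_integral_cmult) auto
  also have "\<dots> = (\<integral>\<^sup>+r. ennreal (?p * r powr (- \<alpha> - 1)) *
       (\<integral>\<^sup>+z. ennreal (translation_distance (r *\<^sub>R z)) * indicator K z \<partial>lborel) * indicator {0<..} r \<partial>lborel)"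
  proof (rule nn_integral_cong)
    fix r :: real
    show "?q r * (\<integral>\<^sup>+y. ennreal (translation_distance y) * indicator K (inverse r *\<^sub>R y) \<partial>lborel) =
      ennreal (?p * r powr (- \<alpha> - 1)) *
       (\<integral>\<^sup>+z. ennreal (translation_distance (r *\<^sub>R z)) * indicator K z \<partial>lborel) * indicator {0<..} r"
    proof (cases "r > 0")
      case True
      have "(\<integral>\<^sup>+y. ennreal (translation_distance y) * indicator K (inverse r *\<^sub>R y) \<partial>lborel) =
          ennreal (r ^ DIM('a)) * (\<integral>\<^sup>+z. ennreal (translation_distance (r *\<^sub>R z)) * indicator K (inverse r *\<^sub>R (r *\<^sub>R z)) \<partial>lborel)"
        by (rule nn_integral_lborel_scaleR[OF _ True]) measurable
      also have "\<dots> = ennreal (r ^ DIM('a)) * (\<integral>\<^sup>+z. ennreal (translation_distance (r *\<^sub>R z)) * indicator K z \<partial>lborel)"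
        using True by simp
      finally have *: "(\<integral>\<^sup>+y. ennreal (translation_distance y) * indicator K (inverse r *\<^sub>R y) \<partial>lborel) =
        ennreal (r ^ DIM('a)) * (\<integral>\<^sup>+z. ennreal (translation_distance (r *\<^sub>R z)) * indicator K z \<partial>lborel)" .
      \<comment> \<open>The Jacobian of the dilation cancels the dimension in the exponent.\<close>
      have "r powr (- ?p - 1) * r ^ DIM('a) = r powr (- \<alpha> - 1)"
        using True by (simp add: powr_realpow[symmetric] powr_add[symmetric])
      then have "ennreal (?p * r powr (- ?p - 1)) * ennreal (r ^ DIM('a)) = ennreal (?p * r powr (- \<alpha> - 1))"
        using True \<alpha> by (simp add: ennreal_mult'[symmetric] mult.assoc)
      then show ?thesis using True unfolding * by (simp add: mult.assoc[symmetric])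
    qed auto
  qed
  finally show ?thesis .
qed

text \<open>The concentration lemma is applied to the average of the translation distance over
  \<open>K\<close>. Its linear bound, constant bound and lower bound near 0 come from the bound by
  \<open>dir_variation\<close>, the L1 bound and the averaged quotient limit.\<close>

lemma fractional_seminorm_limit:
  fixes K :: "'a set"
  assumes K: "compact K" "convex K" "0 \<in> interior K"
  shows "((\<lambda>\<alpha>. ennreal (1 - \<alpha>) *
      (\<integral>\<^sup>+x. (\<integral>\<^sup>+y. ennreal (\<bar>g (x + y) - g x\<bar> / body_norm K y powr (real DIM('a) + \<alpha>)) \<partial>lborel) \<partial>lborel))
    \<longlongrightarrow> ennreal ((real DIM('a) + 1) * (LINT z|lborel. indicator K z * dir_variation z))) (at_left 1)"
proof -
  have [measurable]: "K \<in> sets borel" using K(1) by (rule borel_compact)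
  define G where "G r = (\<integral>\<^sup>+z. ennreal (translation_distance (r *\<^sub>R z)) * indicator K z \<partial>lborel)" for r
  let ?D = "\<lambda>r. LINT z|lborel. indicator K z * translation_distance (r *\<^sub>R z)"
  let ?w = "LINT z|lborel. indicator K z * dir_variation z"
  let ?C = "2 * (LINT x|lborel. \<bar>g x\<bar>) * measure lborel K"
  have G: "G r = ennreal (?D r)" for r
  proof -
    have "G r = (\<integral>\<^sup>+z. ennreal (indicator K z * translation_distance (r *\<^sub>R z)) \<partial>lborel)"
      unfolding G_def by (intro nn_integral_cong) (auto split: split_indicator)
    also have "\<dots> = ennreal (?D r)"
      using translation_distance_integrable_on_compact[OF K(1)] translation_distance_nonneg
      by (intro nn_integral_eq_integral) auto
    finally show ?thesis .
  qed
  have "((\<lambda>\<alpha>. ennreal (1 - \<alpha>) *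
      (\<integral>\<^sup>+r. ennreal ((real DIM('a) + \<alpha>) * r powr (- \<alpha> - 1)) * G r * indicator {0<..} r \<partial>lborel))
    \<longlongrightarrow> ennreal ((real DIM('a) + 1) * ?w)) (at_left 1)"
  proof (rule concentration_limit[where C = ?C])
    show "G \<in> borel_measurable borel" unfolding G_def by measurable
    show "0 \<le> ?w" using dir_variation_nonneg by simp
    show "0 \<le> ?C" by simp
    fix r :: real assume "r > 0"
    have "?D r \<le> (LINT z|lborel. r * (indicator K z * dir_variation z))"
    proof (rule integral_mono)
      show "indicator K z * translation_distance (r *\<^sub>R z) \<le> r * (indicator K z * dir_variation z)" for z
        using translation_distance_le_dir_variation[of "r *\<^sub>R z"] \<open>r > 0\<close>
        by (auto simp: dir_variation_scaleR split: split_indicator)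
    qed (intro translation_distance_integrable_on_compact integrable_mult_right dir_variation_integrable_on_compact K)+
    then show "G r \<le> ennreal (r * ?w)" unfolding G by (intro ennreal_leI) simp
    have "?D r \<le> (LINT z|lborel. indicator K z * (2 * (LINT x|lborel. \<bar>g x\<bar>)))"
    proof (rule integral_mono)
      show "integrable lborel (\<lambda>z. indicator K z * (2 * (LINT x|lborel. \<bar>g x\<bar>)))"
        using emeasure_compact_finite[OF K(1)] by (intro integrable_mult_left integrable_real_indicator) auto
      show "indicator K z * translation_distance (r *\<^sub>R z) \<le> indicator K z * (2 * (LINT x|lborel. \<bar>g x\<bar>))" for z
        using translation_distance_le_L1[of "r *\<^sub>R z"] by (auto split: split_indicator)
    qed (intro translation_distance_integrable_on_compact K)
    then show "G r \<le> ennreal ?C" unfolding G by (intro ennreal_leI) (simp add: mult_ac)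
  next
    fix a assume "a < ?w"
    then have "\<forall>\<^sub>F r in at_right 0. a < ?D r / r"
      by (rule order_tendstoD(1)[OF averaged_translation_quotient_tendsto[OF K(1)]])
    then show "\<forall>\<^sub>F r in at_right 0. ennreal (r * a) \<le> G r"
      using eventually_at_right_less[of 0]
      by eventually_elim (simp add: G pos_less_divide_eq mult.commute ennreal_leI less_imp_le)
  qed simp
  \<comment> \<open>The layer-cake identity is available for \<alpha> > 0 only, which holds
    eventually as \<alpha> increases to 1.\<close>
  then show ?thesis
  proof (rule Lim_transform_eventually)
    have "\<forall>\<^sub>F \<alpha> in at_left 1. 0 < \<alpha> \<and> \<alpha> < (1::real)"
      unfolding eventually_at_left_field by (intro exI[of _ 0]) auto
    then show "\<forall>\<^sub>F \<alpha> in at_left 1. ennreal (1 - \<alpha>) *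
        (\<integral>\<^sup>+r. ennreal ((real DIM('a) + \<alpha>) * r powr (- \<alpha> - 1)) * G r * indicator {0<..} r \<partial>lborel) =
      ennreal (1 - \<alpha>) *
        (\<integral>\<^sup>+x. (\<integral>\<^sup>+y. ennreal (\<bar>g (x + y) - g x\<bar> / body_norm K y powr (real DIM('a) + \<alpha>)) \<partial>lborel) \<partial>lborel)"
      by eventually_elim (simp add: fractional_seminorm_layer_cake[OF K] G_def)
  qed
qed

text \<open>Tonelli for \<open>\<mu>\<close> and Lebesgue measure on \<open>K\<close>. Up to the
  factor (d + 1) / 2 the left-hand side is the anisotropic semi-norm, and the right-hand side
  contains the integral found in the limit.\<close>

lemma nn_integral_dir_variation:
  assumes "compact K"
  shows "(\<integral>\<^sup>+x. ennreal (LINT z|lborel. indicator K z * \<bar>\<sigma> x \<bullet> z\<bar>) \<partial>\<mu>) =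
    ennreal (LINT z|lborel. indicator K z * dir_variation z)"
proof -
  interpret mu: finite_measure \<mu> by (rule finite_mu)
  interpret pair_sigma_finite \<mu> lborel ..
  have [measurable]: "K \<in> sets borel" using assms by (rule borel_compact)
  have m: "(\<lambda>(x, z). ennreal (indicator K z * \<bar>\<sigma> x \<bullet> z\<bar>)) \<in> borel_measurable (\<mu> \<Otimes>\<^sub>M lborel)"
  proof -
    have "(\<lambda>(x, z). ennreal (indicator K z * \<bar>\<sigma> x \<bullet> z\<bar>)) \<in> borel_measurable (borel \<Otimes>\<^sub>M borel)" by measurable
    then show ?thesis
      by (simp add: measurable_cong_sets[OF sets_pair_measure_cong[OF sets_mu sets_lborel] refl])
  qed
  note i = integrable_inner_on_compact[OF assms]
  have "(\<integral>\<^sup>+x. ennreal (LINT z|lborel. indicator K z * \<bar>\<sigma> x \<bullet> z\<bar>) \<partial>\<mu>) =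
      (\<integral>\<^sup>+x. (\<integral>\<^sup>+z. ennreal (indicator K z * \<bar>\<sigma> x \<bullet> z\<bar>) \<partial>lborel) \<partial>\<mu>)"
    using i by (intro nn_integral_cong nn_integral_eq_integral[symmetric]) auto
  also have "\<dots> = (\<integral>\<^sup>+z. (\<integral>\<^sup>+x. ennreal (indicator K z * \<bar>\<sigma> x \<bullet> z\<bar>) \<partial>\<mu>) \<partial>lborel)"
    using Fubini'[OF m] by simp
  also have "\<dots> = (\<integral>\<^sup>+z. ennreal (indicator K z * dir_variation z) \<partial>lborel)"
  proof (rule nn_integral_cong)
    fix z
    show "(\<integral>\<^sup>+x. ennreal (indicator K z * \<bar>\<sigma> x \<bullet> z\<bar>) \<partial>\<mu>) = ennreal (indicator K z * dir_variation z)"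
      using sigma_inner_integrable[of z]
      by (subst nn_integral_eq_integral) (auto simp: dir_variation_def)
  qed
  also have "\<dots> = ennreal (LINT z|lborel. indicator K z * dir_variation z)"
    using dir_variation_integrable_on_compact[OF assms] dir_variation_nonneg
    by (intro nn_integral_eq_integral) auto
  finally show ?thesis .
qed

end

section \<open>The norm polar to the moment body\<close>

text \<open>For nonempty bounded \<open>L\<close> the infimum is the positive part of the support
  function of \<open>L\<close>.\<close>

lemma body_norm_polar: "body_norm (polar_body L) y = Inf {l. l > 0 \<and> (\<forall>x\<in>L. x \<bullet> y \<le> l)}"
proof -
  have "{l. l > 0 \<and> inverse l *\<^sub>R y \<in> polar_body L} = {l. l > 0 \<and> (\<forall>x\<in>L. x \<bullet> y \<le> l)}"
    by (auto simp: polar_body_def field_simps)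
  then show ?thesis by (simp add: body_norm_def)
qed

text \<open>The two-sided comparison with the Euclidean norm is carried explicitly: the lower bound
  gives the dual ball interior points, the upper bound makes it bounded.\<close>

locale euclidean_norm =
  fixes N :: "'a::euclidean_space \<Rightarrow> real" and c C :: real
  assumes triangle: "N (y + z) \<le> N y + N z"
    and homogeneous: "t \<ge> 0 \<Longrightarrow> N (t *\<^sub>R y) = t * N y"
    and lower: "c * norm y \<le> N y" and c_pos: "c > 0"
    and upper: "N y \<le> C * norm y"
begin

lemma N_pos: "y \<noteq> 0 \<Longrightarrow> N y > 0"
  using lower[of y] c_pos by (smt (verit) mult_pos_pos zero_less_norm_iff)

lemma N_0: "N 0 = 0"
  using homogeneous[of 0 0] by simp

text \<open>Hahn-Banach in finite dimension: a hyperplane separates the open unit ball of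
  \<open>N\<close> from the normalised point \<open>y\<close>, and its normal is rescaled.\<close>

lemma supporting_functional:
  assumes y: "y \<noteq> 0"
  obtains x where "x \<bullet> y = N y" "\<And>z. x \<bullet> z \<le> N z"
proof -
  let ?S = "{z. N z < 1}" and ?y = "inverse (N y) *\<^sub>R y"
  have Ny: "N y > 0" by (rule N_pos[OF y])
  have "convex ?S"
  proof (rule convexI)
    fix u v s t assume *: "u \<in> ?S" "v \<in> ?S" "0 \<le> s" "0 \<le> t" "s + t = (1::real)"
    have "N (s *\<^sub>R u + t *\<^sub>R v) \<le> s * N u + t * N v"
      using triangle[of "s *\<^sub>R u" "t *\<^sub>R v"] * by (simp add: homogeneous)
    also have "\<dots> < 1"
      using convex_bound_lt[of "N u" 1 "N v" s t] * by simp
    finally show "s *\<^sub>R u + t *\<^sub>R v \<in> ?S" by simp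
  qed
  moreover have "?S \<inter> {?y} = {}"
    using Ny by (auto simp: homogeneous)
  moreover have "0 \<in> ?S" by (simp add: N_0)
  ultimately obtain a b where ab: "a \<noteq> 0" "\<And>z. z \<in> ?S \<Longrightarrow> a \<bullet> z \<le> b" "b \<le> a \<bullet> ?y"
    using separating_hyperplane_sets[of ?S "{?y}"] by auto
  \<comment> \<open>The unit ball contains a positive multiple of \<open>a\<close> itself, on which
    the functional is positive.\<close>
  have b: "b > 0"
  proof -
    have Na: "N a > 0" by (rule N_pos[OF ab(1)])
    have "inverse (2 * N a) *\<^sub>R a \<in> ?S" using Na by (simp add: homogeneous)
    then have "a \<bullet> (inverse (2 * N a) *\<^sub>R a) \<le> b" by (rule ab(2))
    moreover have "a \<bullet> (inverse (2 * N a) *\<^sub>R a) > 0" using Na ab(1) by simp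
    ultimately show ?thesis by linarith
  qed
  define m where "m = a \<bullet> ?y"
  have m: "m > 0" "b \<le> m" using b ab(3) by (auto simp: m_def)
  show ?thesis
  proof
    have "a \<bullet> y = m * N y" using Ny by (simp add: m_def)
    then show "(inverse m *\<^sub>R a) \<bullet> y = N y" using m by simp
    fix z
    show "(inverse m *\<^sub>R a) \<bullet> z \<le> N z"
    \<comment> \<open>Separation speaks of the open ball, so \<open>z\<close> is scaled by an
      arbitrary \<open>s\<close> above \<open>N z\<close> instead of by \<open>N z\<close>.\<close>
    proof (rule dense_ge)
      fix s assume s: "N z < s"
      have "0 \<le> N z" using N_pos[of z] N_0 by (cases "z = 0") auto
      with s have "s > 0" by linarith
      then have "inverse s *\<^sub>R z \<in> ?S" using s by (simp add: homogeneous field_simps)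
      then have "a \<bullet> (inverse s *\<^sub>R z) \<le> m" using ab(2) m by fastforce
      then have "a \<bullet> z \<le> s * m" using \<open>s > 0\<close> by (simp add: field_simps)
      then show "(inverse m *\<^sub>R a) \<bullet> z \<le> s" using m by (simp add: field_simps)
    qed
  qed
qed

text \<open>The convex body whose support function is \<open>N\<close>; it is the candidate for the
  moment body.\<close>

definition dual_ball :: "'a set" where
  "dual_ball = {x. \<forall>y. x \<bullet> y \<le> N y}"

lemma convex_body_dual_ball: "convex_body dual_ball"
proof -
  have eq: "dual_ball = (\<Inter>y. {x. y \<bullet> x \<le> N y})" by (auto simp: dual_ball_def inner_commute)
  have "closed dual_ball" unfolding eq by (intro closed_INT ballI closed_halfspace_le)
  moreover have "convex dual_ball" unfolding eq by (intro convex_INT convex_halfspace_le)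
  moreover have "bounded dual_ball"
  proof (rule boundedI)
    fix x assume "x \<in> dual_ball"
    then have "x \<bullet> x \<le> N x" by (simp only: dual_ball_def mem_Collect_eq)
    then have "x \<bullet> x \<le> C * norm x" using upper[of x] by linarith
    then have "norm x * norm x \<le> C * norm x" by (simp add: power2_norm_eq_inner[symmetric] power2_eq_square)
    then show "norm x \<le> max C 0" by (cases "x = 0") auto
  qed
  moreover have "ball 0 c \<subseteq> dual_ball"
  proof
    fix x :: 'a assume "x \<in> ball 0 c"
    then have x: "norm x \<le> c" by simp
    have "x \<bullet> y \<le> N y" for y
    proof -
      have "x \<bullet> y \<le> norm x * norm y" by (rule norm_cauchy_schwarz)
      also have "\<dots> \<le> c * norm y" using x by (intro mult_right_mono) auto
      also have "\<dots> \<le> N y" by (rule lower)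
      finally show ?thesis .
    qed
    then show "x \<in> dual_ball" by (simp add: dual_ball_def)
  qed
  then have "0 \<in> interior dual_ball" using c_pos by (meson centre_in_ball interior_maximal open_ball subsetD)
  ultimately show ?thesis by (auto simp: convex_body_def compact_eq_bounded_closed)
qed

lemma body_norm_polar_dual_ball: "body_norm (polar_body dual_ball) y = N y"
proof (cases "y = 0")
  case True
  \<comment> \<open>At the origin every positive \<open>l\<close> is admissible and the infimum 0 is
    not attained, unlike for nonzero \<open>y\<close>.\<close>
  have "{l::real. l > 0 \<and> (\<forall>x\<in>dual_ball. x \<bullet> 0 \<le> l)} = {0<..}" by auto
  then have "body_norm (polar_body dual_ball) 0 = Inf {0<..}" by (simp only: body_norm_polar)
  then show ?thesis using True by (simp add: N_0)
next
  case False
  obtain x where x: "x \<bullet> y = N y" "\<And>z. x \<bullet> z \<le> N z" using supporting_functional[OF False] by blast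
  have xd: "x \<in> dual_ball" using x(2) unfolding dual_ball_def by blast
  have le: "u \<bullet> y \<le> N y" if "u \<in> dual_ball" for u using that unfolding dual_ball_def by blast
  have "{l. l > 0 \<and> (\<forall>x\<in>dual_ball. x \<bullet> y \<le> l)} = {N y..}"
  proof (intro set_eqI iffI)
    fix l assume "l \<in> {l. l > 0 \<and> (\<forall>x\<in>dual_ball. x \<bullet> y \<le> l)}"
    then have "x \<bullet> y \<le> l" using xd by blast
    then show "l \<in> {N y..}" using x(1) by simp
  next
    fix l assume "l \<in> {N y..}"
    then have l: "N y \<le> l" by simp
    then have "l > 0" using N_pos[OF False] by linarith
    moreover have "u \<bullet> y \<le> l" if "u \<in> dual_ball" for u using le[OF that] l by linarith
    ultimately show "l \<in> {l. l > 0 \<and> (\<forall>x\<in>dual_ball. x \<bullet> y \<le> l)}" by blast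
  qed
  then show ?thesis by (simp add: body_norm_polar)
qed

text \<open>A convex body is determined by its support function. The polar gauge records only the
  positive part of that function, but \<open>N\<close> is positive off the origin, so a separating
  direction still yields a contradiction.\<close>

lemma dual_ball_unique:
  assumes L: "convex_body L" and eq: "\<And>y. body_norm (polar_body L) y = N y"
  shows "L = dual_ball"
proof
  have L': "compact L" "convex L" using L by (auto simp: convex_body_def)
  have bdd: "bdd_below {l::real. l > 0 \<and> (\<forall>x\<in>L. x \<bullet> y \<le> l)}" for y
    by (rule bdd_belowI[of _ 0]) auto
  show "L \<subseteq> dual_ball"
  proof
    fix x assume x: "x \<in> L"
    obtain B where B: "B > 0" "\<And>x. x \<in> L \<Longrightarrow> norm x \<le> B"
      using compact_imp_bounded[OF L'(1)] bounded_pos by blast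
    have "x \<bullet> y \<le> N y" for y
    proof -
      have "B * norm y + 1 \<in> {l. l > 0 \<and> (\<forall>x\<in>L. x \<bullet> y \<le> l)}"
      proof (intro CollectI conjI ballI)
        show "0 < B * norm y + 1" using B by (simp add: add_nonneg_pos)
        fix u assume "u \<in> L"
        have "u \<bullet> y \<le> norm u * norm y" by (rule norm_cauchy_schwarz)
        also have "\<dots> \<le> B * norm y" using B(2)[OF \<open>u \<in> L\<close>] by (intro mult_right_mono) auto
        finally show "u \<bullet> y \<le> B * norm y + 1" by simp
      qed
      then have "x \<bullet> y \<le> Inf {l. l > 0 \<and> (\<forall>x\<in>L. x \<bullet> y \<le> l)}"
        using x by (intro cInf_greatest) auto
      then show ?thesis using eq[of y] by (simp add: body_norm_polar)
    qed
    then show "x \<in> dual_ball" by (simp add: dual_ball_def)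
  qed
  show "dual_ball \<subseteq> L"
  proof (rule ccontr)
    assume "\<not> dual_ball \<subseteq> L"
    then obtain x0 where x0: "x0 \<in> dual_ball" "x0 \<notin> L" by blast
    obtain a b where ab: "a \<bullet> x0 < b" "\<forall>x\<in>L. a \<bullet> x > b"
      using separating_hyperplane_closed_point[OF L'(2) compact_imp_closed[OF L'(1)] x0(2)] by blast
    have "L \<noteq> {}" using L by (auto simp: convex_body_def)
    then have "a \<noteq> 0" using ab by fastforce
    then have pos: "N (- a) > 0" by (intro N_pos) auto
    have "x0 \<bullet> (- a) \<le> N (- a)" using x0(1) by (simp only: dual_ball_def mem_Collect_eq)
    then have gt: "N (- a) > - b" using ab(1) by (simp add: inner_commute)
    \<comment> \<open>\<open>l\<close> must bound \<open>L\<close> in direction \<open>- a\<close>,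
      be positive to count in the infimum, and stay below \<open>N (- a)\<close>; the second entry
      of the maximum ensures positivity.\<close>
    define l where "l = max (- b) (N (- a) / 2)"
    have "l > 0" "l < N (- a)" using pos gt by (auto simp: l_def)
    moreover have "\<forall>x\<in>L. x \<bullet> (- a) \<le> l"
      using ab(2) by (auto simp: l_def inner_commute le_max_iff_disj less_imp_le)
    ultimately have "Inf {l. l > 0 \<and> (\<forall>x\<in>L. x \<bullet> (- a) \<le> l)} \<le> l"
      by (intro cInf_lower bdd) blast
    then show False using eq[of "- a"] \<open>l < N (- a)\<close> by (simp add: body_norm_polar)
  qed
qed

lemma body_norm_polar_the:
  "body_norm (polar_body (THE L. convex_body L \<and> (\<forall>y. body_norm (polar_body L) y = N y))) y = N y"
proof -
  have "(THE L. convex_body L \<and> (\<forall>y. body_norm (polar_body L) y = N y)) = dual_ball"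
  proof (rule the_equality)
    show "convex_body dual_ball \<and> (\<forall>y. body_norm (polar_body dual_ball) y = N y)"
      using convex_body_dual_ball body_norm_polar_dual_ball by blast
  qed (use dual_ball_unique in blast)
  then show ?thesis using body_norm_polar_dual_ball by simp
qed

end

lemma set_lebesgue_integral_inner:
  fixes K :: "'a::euclidean_space set"
  assumes "compact K"
  shows "set_lebesgue_integral lebesgue K (\<lambda>x. \<bar>y \<bullet> x\<bar>) = (LINT x|lborel. indicator K x * \<bar>y \<bullet> x\<bar>)"
proof -
  have [measurable]: "K \<in> sets borel" using assms by (rule borel_compact)
  show ?thesis unfolding set_lebesgue_integral_def
    by (subst integral_completion) auto
qed

text \<open>The integral on the right defines a norm comparable to the Euclidean one, so the
  definite description of the moment body is resolved by \<open>dual_ball\<close>. Boundedness of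
  \<open>K\<close> gives the upper constant, a ball about the origin inside \<open>K\<close> the
  lower one.\<close>

lemma body_norm_polar_moment_body:
  fixes K :: "'a::euclidean_space set"
  assumes K: "compact K" and 0: "0 \<in> interior K"
  shows "body_norm (polar_body (moment_body K)) y =
    (real DIM('a) + 1) / 2 * (LINT x|lborel. indicator K x * \<bar>y \<bullet> x\<bar>)"
proof -
  let ?k = "(real DIM('a) + 1) / 2"
  let ?J = "\<lambda>y. LINT x|lborel. indicator K x * \<bar>y \<bullet> x\<bar>"
  have [measurable]: "K \<in> sets borel" using K by (rule borel_compact)
  note int = integrable_inner_on_compact[OF K]
  have fin: "emeasure lborel K < \<infinity>" by (rule emeasure_compact_finite[OF K])
  obtain B where B: "B > 0" "\<And>x. x \<in> K \<Longrightarrow> norm x \<le> B"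
    using compact_imp_bounded[OF K] bounded_pos by blast
  obtain e where e: "e > 0" "ball 0 e \<subseteq> K" using 0 by (meson mem_interior)
  define v where "v = measure lborel (ball (0::'a) (e / 4))"
  have v: "v > 0" unfolding v_def using e by (simp add: content_ball_pos)
  \<comment> \<open>The volume does not depend on the centre, so the lower constant does not depend
    on \<open>y\<close>.\<close>
  have vol: "measure lborel (ball a (e / 4)) = v" for a :: 'a
    unfolding v_def using e content_ball[of "e/4" a] content_ball[of "e/4" "0::'a"] by simp
  have "euclidean_norm (\<lambda>y. ?k * ?J y) (?k * (e / 4 * v)) (?k * (B * measure lborel K))"
  proof
    fix y z :: 'a
    have "?J (y + z) \<le> (LINT x|lborel. indicator K x * \<bar>y \<bullet> x\<bar> + indicator K x * \<bar>z \<bullet> x\<bar>)"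
      by (intro integral_mono Bochner_Integration.integrable_add int)
        (auto simp: inner_add_left split: split_indicator)
    also have "\<dots> = ?J y + ?J z" using int by simp
    finally have "?k * ?J (y + z) \<le> ?k * (?J y + ?J z)" by (intro mult_left_mono) auto
    then show "?k * ?J (y + z) \<le> ?k * ?J y + ?k * ?J z" by (simp only: distrib_left)
    show "?k * ?J (t *\<^sub>R y) = t * (?k * ?J y)" if "t \<ge> 0" for t
    proof -
      have "?J (t *\<^sub>R y) = (LINT x|lborel. t * (indicator K x * \<bar>y \<bullet> x\<bar>))"
        using that by (simp add: abs_mult mult_ac)
      then show ?thesis by simp
    qed
    have "e / 4 * v * norm y \<le> ?J y"
    proof (cases "y = 0")
      case False
      \<comment> \<open>The ball of radius \<open>e / 4\<close> about this point of norm
        \<open>e / 2\<close> stays inside \<open>K\<close>, and on it the inner product with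
        \<open>y\<close> is at least \<open>e / 4 * norm y\<close>.\<close>
      define a where "a = (e / (2 * norm y)) *\<^sub>R y"
      have na: "norm a = e / 2" using False e by (simp add: a_def)
      have ya: "y \<bullet> a = norm y * (e / 2)"
        using False by (simp add: a_def power2_norm_eq_inner[symmetric] power2_eq_square)
      have "e / 4 * v * norm y = (LINT x|lborel. indicator (ball a (e / 4)) x * (e / 4 * norm y))"
        by (simp add: vol mult_ac)
      also have "\<dots> \<le> ?J y"
      proof (rule integral_mono)
        show "integrable lborel (\<lambda>x. indicator (ball a (e / 4)) x * (e / 4 * norm y))"
          using emeasure_lborel_ball_finite[of a "e / 4"]
          by (intro integrable_mult_left integrable_real_indicator) auto
        fix x
        have "x \<in> K \<and> e / 4 * norm y \<le> \<bar>y \<bullet> x\<bar>" if "x \<in> ball a (e / 4)"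
        proof
          have d: "norm (x - a) < e / 4" using that by (simp add: dist_norm norm_minus_commute)
          then have "norm x < e" using e(1) na norm_triangle_sub[of x a] by linarith
          then show "x \<in> K" using e by auto
          have "\<bar>y \<bullet> (x - a)\<bar> \<le> norm y * norm (x - a)" by (rule Cauchy_Schwarz_ineq2)
          also have "\<dots> \<le> norm y * (e / 4)" using d by (intro mult_left_mono) auto
          also have "\<dots> = e / 4 * norm y" by simp
          finally have "y \<bullet> a - y \<bullet> x \<le> e / 4 * norm y" unfolding inner_diff_right by linarith
          moreover have "y \<bullet> a = 2 * (e / 4 * norm y)" using ya by simp
          ultimately show "e / 4 * norm y \<le> \<bar>y \<bullet> x\<bar>" by linarith
        qed
        then show "indicator (ball a (e / 4)) x * (e / 4 * norm y) \<le> indicator K x * \<bar>y \<bullet> x\<bar>"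
          by (auto split: split_indicator)
      qed (rule int)
      finally show ?thesis .
    qed simp
    then have "?k * (e / 4 * v * norm y) \<le> ?k * ?J y" by (intro mult_left_mono) auto
    then show "?k * (e / 4 * v) * norm y \<le> ?k * ?J y" by (simp only: mult.assoc)
    show "0 < ?k * (e / 4 * v)" using e v by simp
    have "?J y \<le> (LINT x|lborel. indicator K x * (B * norm y))"
    proof (rule integral_mono)
      show "integrable lborel (\<lambda>x. indicator K x * (B * norm y))"
        using fin by (intro integrable_mult_left integrable_real_indicator) auto
      show "indicator K x * \<bar>y \<bullet> x\<bar> \<le> indicator K x * (B * norm y)" for x
      proof (cases "x \<in> K")
        case True
        have "\<bar>y \<bullet> x\<bar> \<le> norm y * norm x" by (rule Cauchy_Schwarz_ineq2)
        also have "\<dots> \<le> norm y * B" using B(2)[OF True] by (intro mult_left_mono) auto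
        finally show ?thesis using True by (simp add: mult.commute)
      qed auto
    qed (rule int)
    also have "\<dots> = B * measure lborel K * norm y" by simp
    finally have "?k * ?J y \<le> ?k * (B * measure lborel K * norm y)" by (intro mult_left_mono) auto
    then show "?k * ?J y \<le> ?k * (B * measure lborel K) * norm y" by (simp only: mult.assoc)
  qed
  from euclidean_norm.body_norm_polar_the[OF this, of y] show ?thesis
    unfolding moment_body_def set_lebesgue_integral_inner[OF K] .
qed

section \<open>Density of a vector measure with respect to its total variation\<close>

lemma sets_total_variation: "sets (total_variation \<nu>) = sets borel"
  unfolding total_variation_def
  by (simp add: sets_measure_of_conv sets.sigma_sets_eq[of borel, simplified])

lemma null_space_imp_AE: "emeasure M (space M) = 0 \<Longrightarrow> AE x in M. P x"
  by (rule AE_I[of _ _ "space M"]) auto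

lemma null_space_imp_integral_eq_0:
  fixes h :: "'a \<Rightarrow> 'b::{banach, second_countable_topology}"
  assumes "emeasure M (space M) = 0"
  shows "integral\<^sup>L M h = 0"
  by (metis integral_eq_zero_AE null_space_imp_AE[OF assms])

text \<open>Adding the dominating measure turns the signed measure into a positive one, to which the
  Radon-Nikodym theorem applies.\<close>

lemma dominated_signed_measure_density:
  fixes M :: "'a measure" and s :: "'a set \<Rightarrow> real"
  assumes "finite_measure M"
    and dom: "\<And>E. E \<in> sets M \<Longrightarrow> \<bar>s E\<bar> \<le> measure M E"
    and add: "\<And>A. range A \<subseteq> sets M \<Longrightarrow> disjoint_family A \<Longrightarrow> (\<lambda>n. s (A n)) sums s (\<Union>n::nat. A n)"
  obtains h where "integrable M h" "\<And>E. E \<in> sets M \<Longrightarrow> s E = set_lebesgue_integral M E h"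
proof -
  interpret finite_measure M by fact
  define \<kappa> where "\<kappa> E = ennreal (measure M E + s E)" for E
  have nonneg: "0 \<le> measure M E + s E" if "E \<in> sets M" for E using dom[OF that] by linarith
  define N where "N = measure_of (space M) (sets M) \<kappa>"
  have sN: "sets N = sets M" by (simp add: N_def)
  have pos: "positive (sets M) \<kappa>"
    using dom[of "{}"] by (simp add: positive_def \<kappa>_def)
  have ca: "countably_additive (sets M) \<kappa>"
  proof (rule countably_additiveI)
    fix A :: "nat \<Rightarrow> 'a set" assume A: "range A \<subseteq> sets M" "disjoint_family A" "(\<Union>i. A i) \<in> sets M"
    have "(\<lambda>n. measure M (A n) + s (A n)) sums (measure M (\<Union>i. A i) + s (\<Union>i. A i))"
      by (intro sums_add finite_measure_UNION add A)
    then show "(\<Sum>i. \<kappa> (A i)) = \<kappa> (\<Union>i. A i)"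
      unfolding \<kappa>_def using A by (intro suminf_ennreal_eq nonneg) auto
  qed
  have eN: "emeasure N E = \<kappa> E" if "E \<in> sets M" for E
    unfolding N_def by (rule emeasure_measure_of_sigma[OF sets.sigma_algebra_axioms pos ca that])
  have mN: "measure N E = measure M E + s E" if "E \<in> sets M" for E
    using eN[OF that] nonneg[OF that] by (simp add: measure_def \<kappa>_def)
  have spN: "space N = space M" by (rule sets_eq_imp_space_eq[OF sN])
  have finN: "finite_measure N"
    by (rule finite_measureI) (simp add: spN eN \<kappa>_def)
  have ac: "absolutely_continuous M N"
    unfolding absolutely_continuous_def
  proof
    fix E assume E: "E \<in> null_sets M"
    then have "measure M E = 0" by (simp add: null_sets_def measure_def)
    with E show "E \<in> null_sets N" using dom[of E] by (auto simp: null_sets_def eN sN \<kappa>_def)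
  qed
  obtain D where D: "D \<in> borel_measurable M" "AE x in M. RN_deriv M N x = ennreal (D x)" "\<And>x. 0 \<le> D x"
    by (rule real_RN_deriv[OF finN ac sN]) blast
  have dens: "N = density M (\<lambda>x. ennreal (D x))"
  proof -
    have "N = density M (RN_deriv M N)" using density_RN_deriv[OF ac sN] by simp
    also have "\<dots> = density M (\<lambda>x. ennreal (D x))"
      using D by (intro density_cong) auto
    finally show ?thesis .
  qed
  have iD: "integrable M D"
  proof -
    interpret N: finite_measure N by (rule finN)
    have "integrable N (\<lambda>x. 1::real)" by simp
    then show ?thesis unfolding dens using D by (subst (asm) integrable_density) auto
  qed
  show ?thesis
  proof
    \<comment> \<open>\<open>D\<close> is the density of \<open>s\<close> plus \<open>M\<close>;
      removing \<open>M\<close> again subtracts 1.\<close>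
    show "integrable M (\<lambda>x. D x - 1)" using iD by simp
    fix E assume E: "E \<in> sets M"
    have "measure N E = (LINT x|N. indicator E x)" using E spN sN by simp
    also have "\<dots> = (LINT x|M. D x *\<^sub>R indicator E x)"
      unfolding dens using D E by (subst integral_density) auto
    finally have 1: "measure N E = (LINT x|M. indicator E x * D x)" by (simp add: mult.commute)
    have "integrable M (\<lambda>x. indicator E x * D x)"
      using integrable_real_mult_indicator[OF E iD] by (simp add: mult.commute)
    moreover have "integrable M (\<lambda>x. indicator E x :: real)"
      using E by (intro integrable_real_indicator) (auto simp: emeasure_eq_measure)
    ultimately have "set_lebesgue_integral M E (\<lambda>x. D x - 1) = (LINT x|M. indicator E x * D x) - (LINT x|M. indicator E x)"
      unfolding set_lebesgue_integral_def by (simp add: right_diff_distrib)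
    also have "(LINT x|M. indicator E x) = measure M E" using E by simp
    finally show "s E = set_lebesgue_integral M E (\<lambda>x. D x - 1)" using 1 mN[OF E] by simp
  qed
qed

text \<open>If the supremum over partitions is a measure, \<open>measure_of\<close> reproduces it,
  and \<open>E\<close> padded with empty sets is one admissible partition.\<close>

lemma norm_le_total_variation:
  assumes E: "E \<in> sets borel"
    and ms: "measure_space UNIV (sets borel) (\<lambda>E. SUP A \<in> {A::nat \<Rightarrow> 'a::euclidean_space set. range A \<subseteq> sets borel \<and>
      disjoint_family A \<and> (\<Union>n. A n) = E}. \<Sum>n. ennreal (norm (\<nu> (A n))))"
  shows "ennreal (norm (\<nu> E)) \<le> emeasure (total_variation \<nu>) E"
proof -
  let ?\<A> = "{A::nat \<Rightarrow> 'a set. range A \<subseteq> sets borel \<and> disjoint_family A \<and> (\<Union>n. A n) = E}"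
  define A where "A n = (if n = 0 then E else {})" for n :: nat
  have "A \<in> ?\<A>" using E by (auto simp: A_def disjoint_family_on_def)
  then have "(\<Sum>n. ennreal (norm (\<nu> (A n)))) \<le> (SUP A\<in>?\<A>. \<Sum>n. ennreal (norm (\<nu> (A n))))"
    by (rule SUP_upper)
  moreover have "ennreal (norm (\<nu> (A 0))) \<le> (\<Sum>n. ennreal (norm (\<nu> (A n))))"
  proof -
    have "(\<Sum>n\<in>{0}. ennreal (norm (\<nu> (A n)))) \<le> (\<Sum>n. ennreal (norm (\<nu> (A n))))"
      by (rule sum_le_suminf) (auto intro: summableI)
    then show ?thesis by (simp only: sum.insert finite.emptyI empty_iff not_False_eq_True sum.empty add_0_right)
  qed
  ultimately have "ennreal (norm (\<nu> E)) \<le> (SUP A\<in>?\<A>. \<Sum>n. ennreal (norm (\<nu> (A n))))"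
    by (simp add: A_def)
  then show ?thesis
    unfolding total_variation_def using E ms
    by (simp add: emeasure_measure_of_conv sets.sigma_sets_eq[of borel, simplified])
qed

text \<open>If the set function in the definition of the total variation were not a measure, then
  \<open>measure_of\<close> would return the zero measure, and the conclusion would still hold. This avoids
  proving that the total variation is countably additive.\<close>

lemma polar_density_representation:
  fixes \<nu> :: "'a::euclidean_space set \<Rightarrow> 'a"
  assumes vm: "vector_measure \<nu>" and fin: "emeasure (total_variation \<nu>) UNIV < \<infinity>"
  obtains \<sigma> where "integrable (total_variation \<nu>) \<sigma>"
    "AE x in total_variation \<nu>. polar_density \<nu> x = \<sigma> x"
    "\<And>\<phi>. vector_integral \<nu> \<phi> = (LINT x|total_variation \<nu>. \<phi> x *\<^sub>R \<sigma> x)"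
proof -
  let ?\<mu> = "total_variation \<nu>"
  have sp: "space ?\<mu> = UNIV" using sets_eq_imp_space_eq[OF sets_total_variation[of \<nu>]] by simp
  interpret finite_measure ?\<mu> by (rule finite_measureI) (use fin sp in auto)
  show ?thesis
  proof (cases "measure_space UNIV (sets borel) (\<lambda>E. SUP A \<in> {A::nat \<Rightarrow> 'a set. range A \<subseteq> sets borel \<and>
      disjoint_family A \<and> (\<Union>n. A n) = E}. \<Sum>n. ennreal (norm (\<nu> (A n))))")
    case False
    then have "emeasure ?\<mu> (space ?\<mu>) = 0"
      unfolding total_variation_def
      by (simp add: emeasure_measure_of_conv sets.sigma_sets_eq[of borel, simplified])
    note * = null_space_imp_AE[OF this] null_space_imp_integral_eq_0[OF this]
    show ?thesis
      by (rule that[of "\<lambda>_. 0"]) (auto simp: vector_integral_def *)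
  next
    case True
    have le: "norm (\<nu> E) \<le> measure ?\<mu> E" if "E \<in> sets borel" for E
      using norm_le_total_variation[OF that True] by (simp add: emeasure_eq_measure)
    \<comment> \<open>Each coordinate of \<open>\<nu>\<close> is a signed measure dominated by the
      total variation, so it has a density.\<close>
    have "\<exists>h. integrable ?\<mu> h \<and> (\<forall>E\<in>sets borel. \<nu> E \<bullet> b = set_lebesgue_integral ?\<mu> E h)" if b: "b \<in> Basis" for b
    proof -
      obtain h where "integrable ?\<mu> h" "\<And>E. E \<in> sets ?\<mu> \<Longrightarrow> \<nu> E \<bullet> b = set_lebesgue_integral ?\<mu> E h"
      proof (rule dominated_signed_measure_density[of ?\<mu> "\<lambda>E. \<nu> E \<bullet> b"])
        show "finite_measure ?\<mu>" by (rule finite_measure_axioms)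
        show "\<bar>\<nu> E \<bullet> b\<bar> \<le> measure ?\<mu> E" if "E \<in> sets ?\<mu>" for E
          using le[of E] Basis_le_norm[OF b, of "\<nu> E"] that by (simp add: sets_total_variation)
        show "(\<lambda>n. \<nu> (A n) \<bullet> b) sums (\<nu> (\<Union>n. A n) \<bullet> b)"
          if "range A \<subseteq> sets ?\<mu>" "disjoint_family A" for A :: "nat \<Rightarrow> 'a set"
        proof -
          have "(\<lambda>n. \<nu> (A n)) sums \<nu> (\<Union>n. A n)"
            using vm that unfolding vector_measure_def by (simp add: sets_total_variation)
          then show ?thesis by (rule bounded_linear.sums[OF bounded_linear_inner_left])
        qed
      qed blast
      then show ?thesis by (auto simp: sets_total_variation)
    qed
    then obtain h where h: "\<And>b. b \<in> Basis \<Longrightarrow> integrable ?\<mu> (h b)"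
      "\<And>b E. b \<in> Basis \<Longrightarrow> E \<in> sets borel \<Longrightarrow> \<nu> E \<bullet> b = set_lebesgue_integral ?\<mu> E (h b)"
      by metis
    define \<sigma> where "\<sigma> x = (\<Sum>b\<in>Basis. h b x *\<^sub>R b)" for x
    have i: "integrable ?\<mu> \<sigma>" unfolding \<sigma>_def using h(1) by auto
    have "\<nu> E = set_lebesgue_integral ?\<mu> E \<sigma>" if E: "E \<in> sets borel" for E
    proof (rule euclidean_eqI)
      fix b :: 'a assume b: "b \<in> Basis"
      have "integrable ?\<mu> (\<lambda>x. indicator E x *\<^sub>R \<sigma> x)"
        using i E by (intro integrable_mult_indicator) (auto simp: sets_total_variation)
      then have "set_lebesgue_integral ?\<mu> E \<sigma> \<bullet> b = (LINT x|?\<mu>. (indicator E x *\<^sub>R \<sigma> x) \<bullet> b)"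
        unfolding set_lebesgue_integral_def by (simp only: integral_inner_left)
      also have "\<dots> = set_lebesgue_integral ?\<mu> E (h b)"
        unfolding set_lebesgue_integral_def \<sigma>_def using b by (simp add: inner_sum_left inner_Basis sum.delta if_distrib cong: if_cong)
      finally show "\<nu> E \<bullet> b = set_lebesgue_integral ?\<mu> E \<sigma> \<bullet> b" using h(2)[OF b E] by simp
    qed
    \<comment> \<open>The density just assembled serves as a witness for the choice in
      \<open>polar_density\<close>; the chosen function itself is then returned.\<close>
    then have "integrable ?\<mu> (polar_density \<nu>)"
      unfolding polar_density_def
      using someI_ex[of "\<lambda>\<sigma>. integrable ?\<mu> \<sigma> \<and> (\<forall>E\<in>sets borel. \<nu> E = set_lebesgue_integral ?\<mu> E \<sigma>)"] i
      by blast
    then show ?thesis by (rule that) (auto simp: vector_integral_def)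
  qed
qed

section \<open>The limit for BV functions\<close>

lemma AE_lborel_translate:
  fixes c :: "'a::euclidean_space"
  assumes "AE x in lborel. P x"
  shows "AE x in lborel. P (c + x)"
proof -
  obtain Z where Z: "{x \<in> space lborel. \<not> P x} \<subseteq> Z" "Z \<in> null_sets lborel"
    using assms by (auto simp: eventually_ae_filter)
  have "AE x in distr lborel borel ((+) c). x \<notin> Z"
    using AE_not_in[OF Z(2)] by (simp only: lborel_distr_plus)
  moreover have "{x \<in> space borel. x \<notin> Z} \<in> sets borel"
    using Z(2) by (auto simp: null_sets_def Compl_eq[symmetric])
  ultimately have "AE x in lborel. c + x \<notin> Z" by (subst (asm) AE_distr_iff) auto
  then show ?thesis by eventually_elim (use Z(1) in auto)
qed

text \<open>The outer exceptional set is where \<open>f\<close> and \<open>g\<close> differ; for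
  fixed \<open>x\<close> the inner one is a translate of it, again a null set.\<close>

lemma nn_integral_difference_cong_AE:
  fixes f g :: "'a::euclidean_space \<Rightarrow> real"
  assumes fg: "AE x in lborel. f x = g x"
  shows "(\<integral>\<^sup>+x. (\<integral>\<^sup>+y. ennreal (\<bar>f (x + y) - f x\<bar> / k y) \<partial>lebesgue) \<partial>lebesgue) =
    (\<integral>\<^sup>+x. (\<integral>\<^sup>+y. ennreal (\<bar>g (x + y) - g x\<bar> / k y) \<partial>lborel) \<partial>lborel)"
  unfolding nn_integral_completion
proof (rule nn_integral_cong_AE, use fg in eventually_elim)
  fix x assume x: "f x = g x"
  show "(\<integral>\<^sup>+y. ennreal (\<bar>f (x + y) - f x\<bar> / k y) \<partial>lborel) = (\<integral>\<^sup>+y. ennreal (\<bar>g (x + y) - g x\<bar> / k y) \<partial>lborel)"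
    by (rule nn_integral_cong_AE, use AE_lborel_translate[OF fg, of x] in eventually_elim) (simp add: x)
qed

theorem proposition3p10:
  fixes K :: "'a::euclidean_space set" and f :: "'a \<Rightarrow> real"
  assumes "convex_body K" and "origin_symmetric K"
    and "f \<in> BV"
  shows "((\<lambda>\<alpha>::real. ennreal (1 - \<alpha>) *
            (\<integral>\<^sup>+x. (\<integral>\<^sup>+y. ennreal (\<bar>f (x + y) - f x\<bar> / body_norm K y powr (real DIM('a) + \<alpha>))
               \<partial>lebesgue) \<partial>lebesgue))
          \<longlongrightarrow> 2 * anisotropic_BV_seminorm (moment_body K) f) (at_left 1)"
proof -
  have K: "compact K" "convex K" using assms(1) by (auto simp: convex_body_def)
  have [measurable]: "K \<in> sets borel" using K(1) by (rule borel_compact)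
  have K0: "0 \<in> interior K" by (rule origin_symmetric_interior[OF assms(1,2)])
  define \<nu> where "\<nu> = gradient_measure f"
  define \<mu> where "\<mu> = total_variation \<nu>"
  have f: "integrable lebesgue f" "\<exists>\<nu>. is_gradient_measure f \<nu>" using assms(3) by (auto simp: BV_def)
  have "is_gradient_measure f \<nu>" unfolding \<nu>_def gradient_measure_def using f(2) by (rule someI_ex)
  then have \<nu>: "vector_measure \<nu>" "emeasure \<mu> UNIV < \<infinity>"
    "\<And>\<phi> b. test_function \<phi> \<Longrightarrow> b \<in> Basis \<Longrightarrow>
        (LINT x|lebesgue. f x * frechet_derivative \<phi> (at x) b) = - (vector_integral \<nu> \<phi> \<bullet> b)"
    by (auto simp: is_gradient_measure_def \<mu>_def)
  have s\<mu>: "sets \<mu> = sets borel" by (simp add: \<mu>_def sets_total_variation)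
  obtain \<sigma> where \<sigma>: "integrable \<mu> \<sigma>" "AE x in \<mu>. polar_density \<nu> x = \<sigma> x"
    "\<And>\<phi>. vector_integral \<nu> \<phi> = (LINT x|\<mu>. \<phi> x *\<^sub>R \<sigma> x)"
    using polar_density_representation[OF \<nu>(1)] \<nu>(2) unfolding \<mu>_def by blast
  \<comment> \<open>A Borel representative has the same pairings with test functions and the same
    double integral, so it inherits the gradient of \<open>f\<close> and may replace it.\<close>
  obtain g where g[measurable]: "g \<in> borel_measurable borel" and fg: "AE x in lborel. f x = g x"
    using completion_ex_borel_measurable_real[of f lborel] f(1) by auto
  have fg': "AE x in lebesgue. f x = g x" using fg by (rule AE_completion)
  have f_meas: "f \<in> borel_measurable lebesgue" using f(1) by auto
  interpret gradient_density g \<mu> \<sigma>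
  proof (rule gradient_density.intro)
    have "integrable lebesgue g"
      by (rule integrable_cong_AE_imp[OF f(1)]) (use fg' in \<open>auto intro: measurable_completion elim: eventually_mono\<close>)
    then show "integrable lborel g" by (simp add: integrable_completion)
    show "sets \<mu> = sets borel" by (rule s\<mu>)
    show "finite_measure \<mu>"
      by (rule finite_measureI) (use \<nu>(2) sets_eq_imp_space_eq[OF s\<mu>] in auto)
    show "integrable \<mu> \<sigma>" by (rule \<sigma>(1))
    fix \<phi> :: "'a \<Rightarrow> real" and b :: 'a assume \<phi>: "test_function \<phi>" and b: "b \<in> Basis"
    note [measurable] = test_function_derivative_borel_measurable[OF \<phi> b] test_function_imp_borel_measurable[OF \<phi>]
    obtain B where B: "\<And>x. \<bar>\<phi> x\<bar> \<le> B" using test_function_bounded[OF \<phi>] by blast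
    have i: "integrable \<mu> (\<lambda>x. \<phi> x *\<^sub>R \<sigma> x)"
    proof (rule Bochner_Integration.integrable_bound[OF integrable_scaleR_right[OF \<sigma>(1), of B]])
      show "(\<lambda>x. \<phi> x *\<^sub>R \<sigma> x) \<in> borel_measurable \<mu>"
      proof (rule borel_measurable_scaleR)
        show "\<phi> \<in> borel_measurable \<mu>"
          using test_function_imp_borel_measurable[OF \<phi>] by (simp add: measurable_cong_sets[OF s\<mu> refl])
        show "\<sigma> \<in> borel_measurable \<mu>" using \<sigma>(1) by simp
      qed
      show "AE x in \<mu>. norm (\<phi> x *\<^sub>R \<sigma> x) \<le> norm (B *\<^sub>R \<sigma> x)"
        using B by (intro AE_I2) (auto intro!: mult_right_mono order_trans[OF _ abs_ge_self])
    qed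
    have "(LINT x|lborel. g x * frechet_derivative \<phi> (at x) b) = (LINT x|lebesgue. g x * frechet_derivative \<phi> (at x) b)"
      by (rule integral_completion[symmetric]) measurable
    also have "\<dots> = (LINT x|lebesgue. f x * frechet_derivative \<phi> (at x) b)"
    proof (rule integral_cong_AE)
      show "(\<lambda>x. g x * frechet_derivative \<phi> (at x) b) \<in> borel_measurable lebesgue"
        by (rule measurable_completion) measurable
      have "(\<lambda>x. frechet_derivative \<phi> (at x) b) \<in> borel_measurable lebesgue"
        by (rule measurable_completion) measurable
      then show "(\<lambda>x. f x * frechet_derivative \<phi> (at x) b) \<in> borel_measurable lebesgue"
        using f_meas by (intro borel_measurable_times)
      show "AE x in lebesgue. g x * frechet_derivative \<phi> (at x) b = f x * frechet_derivative \<phi> (at x) b"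
        using fg' by eventually_elim simp
    qed
    also have "\<dots> = - ((LINT x|\<mu>. \<phi> x *\<^sub>R \<sigma> x) \<bullet> b)" using \<nu>(3)[OF \<phi> b] \<sigma>(3) by simp
    also have "(LINT x|\<mu>. \<phi> x *\<^sub>R \<sigma> x) \<bullet> b = (LINT x|\<mu>. (\<phi> x *\<^sub>R \<sigma> x) \<bullet> b)"
      using i by (rule integral_inner_left[symmetric])
    finally show "(LINT x|lborel. g x * frechet_derivative \<phi> (at x) b) = - (LINT x|\<mu>. \<phi> x * (\<sigma> x \<bullet> b))"
      by simp
  qed
  let ?J = "\<lambda>x. LINT z|lborel. indicator K z * \<bar>\<sigma> x \<bullet> z\<bar>"
  have [measurable]: "?J \<in> borel_measurable \<mu>"
    by (rule borel_imp_mu_measurable) measurable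
  have "anisotropic_BV_seminorm (moment_body K) f =
      (\<integral>\<^sup>+x. ennreal (body_norm (polar_body (moment_body K)) (\<sigma> x)) \<partial>\<mu>)"
    unfolding anisotropic_BV_seminorm_def \<nu>_def[symmetric] \<mu>_def[symmetric]
    by (rule nn_integral_cong_AE, use \<sigma>(2) in eventually_elim) simp
  also have "\<dots> = (\<integral>\<^sup>+x. ennreal ((real DIM('a) + 1) / 2) * ennreal (?J x) \<partial>\<mu>)"
    unfolding body_norm_polar_moment_body[OF K(1) K0] by (subst ennreal_mult') auto
  also have "\<dots> = ennreal ((real DIM('a) + 1) / 2) * ennreal (LINT z|lborel. indicator K z * dir_variation z)"
    by (simp add: nn_integral_cmult nn_integral_dir_variation[OF K(1)])
  finally have "2 * anisotropic_BV_seminorm (moment_body K) f =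
      ennreal 2 * (ennreal ((real DIM('a) + 1) / 2) * ennreal (LINT z|lborel. indicator K z * dir_variation z))"
    by simp
  also have "\<dots> = ennreal (2 * ((real DIM('a) + 1) / 2 * (LINT z|lborel. indicator K z * dir_variation z)))"
    by (subst ennreal_mult'[symmetric], simp)+ (rule refl)
  \<comment> \<open>The factor 2 cancels the denominator in the normalisation of the moment body,
    leaving the value given by \<open>fractional_seminorm_limit\<close>.\<close>
  finally have rhs: "2 * anisotropic_BV_seminorm (moment_body K) f =
      ennreal ((real DIM('a) + 1) * (LINT z|lborel. indicator K z * dir_variation z))"
    by simp
  show ?thesis
    unfolding nn_integral_difference_cong_AE[OF fg] rhs by (rule fractional_seminorm_limit[OF K K0])
qed

end
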